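(* Let $\mathcal{P}$ be a polyomino. (i) For $i\in\mathcal{O}=\{1,3,5,7\}$: $\mathcal{M}$ forms a reduced Gröbner basis of $I_{\mathcal{P}}$ with respect to $<^i_{\mathrm{grevlex}}$ if and only if for any two inner intervals $[a,b]$ and $[b,e]$ of $\mathcal{P}$, at least one of the intervals $[a,f]$ and $[a,g]$ is an inner interval of $\mathcal{P}$, where $f$ and $g$ are the anti-diagonal corners of $[b,e]$. (ii) For $i\in\mathcal{E}=\{2,4,6,8\}$: $\mathcal{M}$ forms a reduced Gröbner basis of $I_{\mathcal{P}}$ with respect to $<^i_{\mathrm{grevlex}}$ if and only if for any two inner intervals $[a,b]$ and $[e,f]$ of $\mathcal{P}$ and any vertex $d$ which is the lower right corner of one of them and the upper left corner of the other, at least one of the pairs $\{a,e\}$, $\{b,f\}$ is the pair of anti-diagonal corners of an inner interval of $\mathcal{P}$.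
   Context: **Polyominoes.** For $a=(i,j),b=(k,\ell)\in\mathbb{N}^2$ with $i\le k$, $j\le \ell$, the interval $[a,b]$ is $\{(r,s)\in\mathbb{N}^2: i\le r\le k,\ j\le s\le \ell\}$. It is proper if $i<k$ and $j<\ell$; then $a$ (lower left) and $b$ (upper right) are its diagonal corners, and $c=(i,\ell)$ (upper left) and $d=(k,j)$ (lower right) are its anti-diagonal corners. A cell is an interval $C=[a,a+(1,1)]$; its vertex set $V(C)$ consists of its four corners, and its edges are $\{a,a+(1,0)\}$, $\{a,a+(0,1)\}$, $\{a+(1,0),a+(1,1)\}$, $\{a+(0,1),a+(1,1)\}$. A polyomino is a finite collection $\mathcal{P}$ of cells such that any two cells $C,D$ of $\mathcal{P}$ are connected by a sequence of cells $C=C_1,\dots,C_m=D$ of $\mathcal{P}$ with $C_t\cap C_{t+1}$ an edge of $C_t$ for every $t<m$. Put $V(\mathcal{P})=\bigcup_{C\in\mathcal{P}}V(C)$. A proper interval $[a,b]$ is an inner interval of $\mathcal{P}$ if all cells contained in $[a,b]$ belong to $\mathcal{P}$. **Polyomino ideal.** Let $\mathbb{K}$ be a field and $S=\mathbb{K}[x_v\mid v\in V(\mathcal{P})]$. $\mathcal{M}$ is the set of all inner 2-minors $x_ax_b-x_cx_d$, where $[a,b]$ ranges over the inner intervals of $\mathcal{P}$ and $c,d$ are the anti-diagonal corners of $[a,b]$; $I_{\mathcal{P}}\subset S$ is the ideal generated by $\mathcal{M}$. When speaking of reduced Gröbner bases, elements of $\mathcal{M}$ are taken up to sign so that leading coefficients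 are $1$. **Orders.** For $a=(a_1,a_2)$, $b=(b_1,b_2)$ in $V(\mathcal{P})$ define total orders $<^1,\dots,<^8$: - $a<^1b$ iff $a_1<b_1$, or $a_1=b_1$ and $a_2>b_2$; - $a<^2b$ iff $a_1>b_1$, or $a_1=b_1$ and $a_2>b_2$; - $a<^3b$ iff $a_1>b_1$, or $a_1=b_1$ and $a_2<b_2$; - $a<^4b$ iff $a_1<b_1$, or $a_1=b_1$ and $a_2<b_2$; - $a<^5b$ iff $a_2<b_2$, or $a_2=b_2$ and $a_1>b_1$; - $a<^6b$ iff $a_2<b_2$, or $a_2=b_2$ and $a_1<b_1$; - $a<^7b$ iff $a_2>b_2$, or $a_2=b_2$ and $a_1<b_1$; - $a<^8b$ iff $a_2>b_2$, or $a_2=b_2$ and $a_1>b_1$. $<^i_{\mathrm{grevlex}}$ is the graded reverse lexicographic monomial order on $S$ whose variables are ordered by $x_a<x_b$ iff $a<^ib$. *)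

theory Defs
  imports
    "HOL-Algebra.Ideal"
    "HOL-Library.Poly_Mapping"
    "HOL-Library.Product_Order"
begin

section \<open>Polyominoes\<close>

text \<open>
  On \<open>nat \<times> nat\<close> the order is componentwise, so for \<open>a \<le> b\<close> the library interval
  \<open>{a..b}\<close> is the interval \<open>[a,b]\<close> of the integer grid.
\<close>

type_synonym vertex = "nat \<times> nat"

definition proper_interval :: "vertex \<Rightarrow> vertex \<Rightarrow> bool" where
  "proper_interval a b \<longleftrightarrow> fst a < fst b \<and> snd a < snd b"

definition upper_left :: "vertex \<Rightarrow> vertex \<Rightarrow> vertex" where
  "upper_left a b = (fst a, snd b)"

definition lower_right :: "vertex \<Rightarrow> vertex \<Rightarrow> vertex" where
  "lower_right a b = (fst b, snd a)"

definition cell :: "vertex \<Rightarrow> vertex set" where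
  "cell a = {a..(fst a + 1, snd a + 1)}"

definition cell_edges :: "vertex \<Rightarrow> vertex set set" where
  "cell_edges a =
     (let a10 = (fst a + 1, snd a); a01 = (fst a, snd a + 1); a11 = (fst a + 1, snd a + 1)
      in {{a, a10}, {a, a01}, {a10, a11}, {a01, a11}})"

definition meet_in_edge :: "vertex set \<Rightarrow> vertex set \<Rightarrow> bool" where
  "meet_in_edge C D \<longleftrightarrow> (\<exists>a. C = cell a \<and> C \<inter> D \<in> cell_edges a)"

definition polyomino :: "vertex set set \<Rightarrow> bool" where
  "polyomino P \<longleftrightarrow>
     finite P \<and> P \<subseteq> range cell \<and>
     (\<forall>C\<in>P. \<forall>D\<in>P. \<exists>Cs. Cs \<noteq> [] \<and> hd Cs = C \<and> last Cs = D \<and> set Cs \<subseteq> P \<and>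
        successively meet_in_edge Cs)"

text \<open>A cell, as a set of grid points, consists of exactly its four corners.\<close>

definition vertices :: "vertex set set \<Rightarrow> vertex set" where
  "vertices P = \<Union>P"

definition inner_interval :: "vertex set set \<Rightarrow> vertex \<Rightarrow> vertex \<Rightarrow> bool" where
  "inner_interval P a b \<longleftrightarrow>
     proper_interval a b \<and> (\<forall>c. cell c \<subseteq> {a..b} \<longrightarrow> cell c \<in> P)"


section \<open>Polynomials, monomial orders and Groebner bases\<close>

type_synonym 'x monom = "'x \<Rightarrow>\<^sub>0 nat"
type_synonym ('x, 'k) mpoly = "('x \<Rightarrow>\<^sub>0 nat) \<Rightarrow>\<^sub>0 'k"

definition var :: "'x \<Rightarrow> ('x, 'k::field) mpoly" where
  "var v = Poly_Mapping.single (Poly_Mapping.single v 1) 1"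

definition poly_ring :: "'x set \<Rightarrow> ('x, 'k::field) mpoly ring" where
  "poly_ring V =
     \<lparr>carrier = {p. \<forall>m\<in>Poly_Mapping.keys p. Poly_Mapping.keys m \<subseteq> V},
      mult = (*), one = 1, zero = 0, add = (+)\<rparr>"

definition monom_dvd :: "'x monom \<Rightarrow> 'x monom \<Rightarrow> bool" where
  "monom_dvd u v \<longleftrightarrow> (\<exists>w. v = u + w)"

definition monom_degree :: "'x monom \<Rightarrow> nat" where
  "monom_degree u = (\<Sum>v\<in>Poly_Mapping.keys u. Poly_Mapping.lookup u v)"

text \<open>
  Strict graded reverse lexicographic order for a strict total order \<open>lt\<close> of the variables:
  among monomials of equal degree, the one with the larger exponent at the smallest variable
  where the two differ is the smaller one.
\<close>

definition grevlex :: "('x \<Rightarrow> 'x \<Rightarrow> bool) \<Rightarrow> 'x monom \<Rightarrow> 'x monom \<Rightarrow> bool" where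
  "grevlex lt u v \<longleftrightarrow>
     monom_degree u < monom_degree v \<or>
     (monom_degree u = monom_degree v \<and>
      (\<exists>y. Poly_Mapping.lookup u y > Poly_Mapping.lookup v y \<and>
           (\<forall>z. lt z y \<longrightarrow> Poly_Mapping.lookup u z = Poly_Mapping.lookup v z)))"

text \<open>Leading data of a polynomial for a strict monomial order; meaningful for nonzero \<open>p\<close>.\<close>

definition lead_monom ::
    "('x monom \<Rightarrow> 'x monom \<Rightarrow> bool) \<Rightarrow> ('x, 'k::field) mpoly \<Rightarrow> 'x monom" where
  "lead_monom ord p =
     (THE m. m \<in> Poly_Mapping.keys p \<and> (\<forall>m'\<in>Poly_Mapping.keys p. m' \<noteq> m \<longrightarrow> ord m' m))"

definition lead_coef ::
    "('x monom \<Rightarrow> 'x monom \<Rightarrow> bool) \<Rightarrow> ('x, 'k::field) mpoly \<Rightarrow> 'k" where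
  "lead_coef ord p = Poly_Mapping.lookup p (lead_monom ord p)"

definition initial_monom ::
    "('x monom \<Rightarrow> 'x monom \<Rightarrow> bool) \<Rightarrow> ('x, 'k::field) mpoly \<Rightarrow> ('x, 'k) mpoly" where
  "initial_monom ord p = Poly_Mapping.single (lead_monom ord p) 1"

definition groebner_basis ::
    "'x set \<Rightarrow> ('x monom \<Rightarrow> 'x monom \<Rightarrow> bool) \<Rightarrow> ('x, 'k::field) mpoly set \<Rightarrow>
     ('x, 'k) mpoly set \<Rightarrow> bool" where
  "groebner_basis V ord I G \<longleftrightarrow>
     finite G \<and> G \<subseteq> I - {0} \<and>
     Idl\<^bsub>poly_ring V\<^esub> (initial_monom ord ` G) =
     Idl\<^bsub>poly_ring V\<^esub> (initial_monom ord ` (I - {0}))"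

definition reduced_groebner_basis ::
    "'x set \<Rightarrow> ('x monom \<Rightarrow> 'x monom \<Rightarrow> bool) \<Rightarrow> ('x, 'k::field) mpoly set \<Rightarrow>
     ('x, 'k) mpoly set \<Rightarrow> bool" where
  "reduced_groebner_basis V ord I G \<longleftrightarrow>
     groebner_basis V ord I G \<and>
     (\<forall>g\<in>G. lead_coef ord g = 1) \<and>
     (\<forall>g\<in>G. \<forall>h\<in>G. g \<noteq> h \<longrightarrow>
        (\<forall>m\<in>Poly_Mapping.keys h. \<not> monom_dvd (lead_monom ord g) m))"


section \<open>Polyomino ideals\<close>

definition inner_minors :: "vertex set set \<Rightarrow> (vertex, 'k::field) mpoly set" where
  "inner_minors P =
     {var a * var b - var (upper_left a b) * var (lower_right a b) | a b. inner_interval P a b}"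

definition polyomino_ideal :: "vertex set set \<Rightarrow> (vertex, 'k::field) mpoly set" where
  "polyomino_ideal P = Idl\<^bsub>poly_ring (vertices P)\<^esub> (inner_minors P)"

text \<open>
  The inner minors up to sign.  The coefficients of an inner minor are \<open>1\<close> and \<open>-1\<close>, so the
  elements of this set have leading coefficient \<open>1\<close>.
\<close>

definition signed_inner_minors ::
    "(vertex monom \<Rightarrow> vertex monom \<Rightarrow> bool) \<Rightarrow> vertex set set \<Rightarrow> (vertex, 'k::field) mpoly set" where
  "signed_inner_minors ord P =
     (\<lambda>f. if lead_coef ord f = 1 then f else - f) ` inner_minors P"

definition minors_form_reduced_gb ::
    "'k::field itself \<Rightarrow> (vertex monom \<Rightarrow> vertex monom \<Rightarrow> bool) \<Rightarrow> vertex set set \<Rightarrow> bool" where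
  "minors_form_reduced_gb K ord P \<longleftrightarrow>
     reduced_groebner_basis (vertices P) ord
       (polyomino_ideal P :: (vertex, 'k) mpoly set) (signed_inner_minors ord P)"

definition vertex_less :: "nat \<Rightarrow> vertex \<Rightarrow> vertex \<Rightarrow> bool" where
  "vertex_less i a b \<longleftrightarrow>
     (i = 1 \<and> (fst a < fst b \<or> fst a = fst b \<and> snd a > snd b)) \<or>
     (i = 2 \<and> (fst a > fst b \<or> fst a = fst b \<and> snd a > snd b)) \<or>
     (i = 3 \<and> (fst a > fst b \<or> fst a = fst b \<and> snd a < snd b)) \<or>
     (i = 4 \<and> (fst a < fst b \<or> fst a = fst b \<and> snd a < snd b)) \<or>
     (i = 5 \<and> (snd a < snd b \<or> snd a = snd b \<and> fst a > fst b)) \<or>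
     (i = 6 \<and> (snd a < snd b \<or> snd a = snd b \<and> fst a < fst b)) \<or>
     (i = 7 \<and> (snd a > snd b \<or> snd a = snd b \<and> fst a < fst b)) \<or>
     (i = 8 \<and> (snd a > snd b \<or> snd a = snd b \<and> fst a > fst b))"

definition antidiagonal_pair :: "vertex set set \<Rightarrow> vertex set \<Rightarrow> bool" where
  "antidiagonal_pair P A \<longleftrightarrow>
     (\<exists>p q. inner_interval P p q \<and> A = {upper_left p q, lower_right p q})"

end

theory Submission
  imports Defs "HOL-Library.Confluence"
begin

text \<open>
  The generators are differences of two monomials, so the Groebner basis property is a property of
  monomial rewriting: each inner minor replaces its leading monomial by the other one, and the
  oriented minors form a Groebner basis if and only if the reductions of every monomial are
  confluent.  If they are, sums of coefficients over the monomials with a given normal form vanish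
  on the ideal, and this forces every leading monomial of the ideal to be reducible
  (\<open>lead_monom_reducible\<close>).  Conversely, two reductions of one monomial differ by an element of the
  ideal, and in a Groebner basis the larger of the two must be reducible again
  (\<open>groebner_basis_reduces_peak\<close>).

  For the odd orders the leading monomial of an inner minor is the product of the diagonal corners,
  for the even orders that of the antidiagonal corners.  By Newman's lemma only overlaps of two
  leading monomials matter.  Two intervals whose leading pairs share a corner of the same kind never
  cause an obstruction: each rectangle needed to join the two reductions lies in one of the two
  intervals.  The remaining overlap consists of two intervals that touch in a single vertex which
  belongs to both leading pairs.  Its two reductions can be joined if one of the two blocks
  completing the touching intervals to a larger rectangle consists of cells of the polyomino
  (\<open>joinable_touching\<close>), and they are distinct and both irreducible otherwise
  (\<open>completes_corners_if_groebner\<close>).  Given the two touching intervals, this is the condition of the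
  theorem.  The even orders reduce to the odd ones by reversing the order of the rows.
\<close>

section \<open>Monomials\<close>

abbreviation lookup :: "('x \<Rightarrow>\<^sub>0 'c::zero) \<Rightarrow> 'x \<Rightarrow> 'c" where
  "lookup \<equiv> Poly_Mapping.lookup"

abbreviation keys :: "('x \<Rightarrow>\<^sub>0 'c::zero) \<Rightarrow> 'x set" where
  "keys \<equiv> Poly_Mapping.keys"

text \<open>
  Monomials are written additively: \<open>xvar v\<close> is the variable at \<open>v\<close> as an exponent vector, and
  \<open>xmon m\<close> is the monomial \<open>m\<close> as a polynomial.
\<close>

abbreviation xvar :: "'x \<Rightarrow> 'x monom" where
  "xvar v \<equiv> Poly_Mapping.single v 1"

abbreviation xmon :: "'x monom \<Rightarrow> ('x, 'k::field) mpoly" where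
  "xmon m \<equiv> Poly_Mapping.single m 1"

text \<open>
  The degree of a monomial when the variable at \<open>v\<close> is given the degree \<open>w v\<close>.
\<close>

definition weight :: "('x \<Rightarrow> nat) \<Rightarrow> 'x monom \<Rightarrow> nat" where
  "weight w u = (\<Sum>v\<in>keys u. lookup u v * w v)"

lemma weight_add: "weight w (u + v) = weight w u + weight w v"
  unfolding weight_def
  by (rule setsum_keys_plus_distrib) (simp_all add: distrib_right)

lemma weight_xvar [simp]: "weight w (xvar v) = w v"
  by (simp add: weight_def)

lemma monom_degree_eq_weight: "monom_degree = weight (\<lambda>_. 1)"
  by (simp add: monom_degree_def weight_def fun_eq_iff)

lemma monom_degree_add: "monom_degree (u + v) = monom_degree u + monom_degree v"
  by (simp add: monom_degree_eq_weight weight_add)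

lemma monom_degree_xvar [simp]: "monom_degree (xvar v) = 1"
  by (simp add: monom_degree_eq_weight del: One_nat_def)

lemma keys_add_monom: "keys (u + v :: 'x monom) = keys u \<union> keys v"
  by (auto simp: in_keys_iff lookup_add)

section \<open>The graded reverse lexicographic order\<close>

locale strict_total_order =
  fixes lt :: "'x \<Rightarrow> 'x \<Rightarrow> bool"
  assumes irrefl: "\<not> lt x x"
    and trans: "lt x y \<Longrightarrow> lt y z \<Longrightarrow> lt x z"
    and total: "x \<noteq> y \<Longrightarrow> lt x y \<or> lt y x"

text \<open>
  The order of the variables from which the monomial order is built.
\<close>

locale variable_order = strict_total_order lt
  for lt :: "'x \<Rightarrow> 'x \<Rightarrow> bool"
begin

lemma asymp: "asymp_on A lt"
  using irrefl trans by (blast intro: asymp_onI)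

lemma transp: "transp_on A lt"
  using trans by (blast intro: transp_onI)

lemma grevlex_irrefl: "\<not> grevlex lt u u"
  by (simp add: grevlex_def)

lemma grevlex_trans:
  assumes "grevlex lt u v" "grevlex lt v w"
  shows "grevlex lt u w"
proof (cases "monom_degree u = monom_degree v \<and> monom_degree v = monom_degree w")
  case True
  then obtain y y' where y: "lookup u y > lookup v y" "\<And>z. lt z y \<Longrightarrow> lookup u z = lookup v z"
    and y': "lookup v y' > lookup w y'" "\<And>z. lt z y' \<Longrightarrow> lookup v z = lookup w z"
    using assms unfolding grevlex_def by auto
  obtain m where m: "m = y \<or> m = y'" "m = y \<or> lt m y" "m = y' \<or> lt m y'"
    using total by blast
  have "lookup u z = lookup w z" if "lt z m" for z
  proof -
    have "lt z y" "lt z y'" using m that trans by blast+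
    then show ?thesis using y(2) y'(2) by simp
  qed
  moreover have "lookup u m > lookup w m"
  proof -
    have "lookup u m \<ge> lookup v m" using m(2) y by fastforce
    moreover have "lookup v m \<ge> lookup w m" using m(3) y' by fastforce
    moreover have "lookup u m > lookup v m \<or> lookup v m > lookup w m" using m(1) y y' by blast
    ultimately show ?thesis by linarith
  qed
  ultimately show ?thesis using True unfolding grevlex_def by auto
next
  case False
  then show ?thesis using assms unfolding grevlex_def by auto
qed

lemma grevlex_total:
  assumes "u \<noteq> v"
  shows "grevlex lt u v \<or> grevlex lt v u"
proof (cases "monom_degree u = monom_degree v")
  case True
  define D where "D = {y. lookup u y \<noteq> lookup v y}"
  have "D \<subseteq> keys u \<union> keys v" by (auto simp: D_def in_keys_iff)
  then have "finite D" by (rule finite_subset) simp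
  moreover have "D \<noteq> {}" using assms by (auto simp: D_def poly_mapping_eq_iff fun_eq_iff)
  ultimately obtain y where y: "y \<in> D" "\<And>x. x \<in> D \<Longrightarrow> x \<noteq> y \<Longrightarrow> \<not> lt x y"
    using Finite_Set.bex_min_element[of D lt] asymp transp by blast
  have "lookup u z = lookup v z" if "lt z y" for z
    using that y irrefl by (auto simp: D_def)
  moreover have "lookup u y \<noteq> lookup v y" using y by (simp add: D_def)
  ultimately show ?thesis using True unfolding grevlex_def
    by (metis linorder_neqE_nat)
next
  case False
  then show ?thesis unfolding grevlex_def by auto
qed

lemma grevlex_add: "grevlex lt u v \<Longrightarrow> grevlex lt (u + s) (v + s)"
  by (auto simp: grevlex_def monom_degree_add lookup_add)

text \<open>
  At equal degree, a monomial divisible by the smallest variable that occurs is smaller than one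
  that is not.
\<close>

lemma grevlex_smallest_variable:
  assumes "monom_degree (xvar y + s) = monom_degree t"
    and "\<And>z. z \<in> keys s \<Longrightarrow> z = y \<or> lt y z"
    and "\<And>z. z \<in> keys t \<Longrightarrow> lt y z"
  shows "grevlex lt (xvar y + s) t"
proof -
  have "lookup t y = 0" using assms(3) irrefl by (auto simp: in_keys_iff)
  moreover have "lookup (xvar y + s) z = lookup t z" if "lt z y" for z
  proof -
    have "z \<noteq> y" "z \<notin> keys s" "z \<notin> keys t" using that assms irrefl trans by blast+
    then show ?thesis by (simp add: lookup_add lookup_single in_keys_iff when_def)
  qed
  moreover have "lookup (xvar y + s) y > 0" by (simp add: lookup_add)
  ultimately show ?thesis using assms(1) unfolding grevlex_def by metis
qed

lemma lead_monom_eqI: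
  assumes "m \<in> keys p" "\<And>m'. m' \<in> keys p \<Longrightarrow> m' \<noteq> m \<Longrightarrow> grevlex lt m' m"
  shows "lead_monom (grevlex lt) p = m"
  unfolding lead_monom_def
proof (rule the_equality)
  show "m \<in> keys p \<and> (\<forall>m'\<in>keys p. m' \<noteq> m \<longrightarrow> grevlex lt m' m)" using assms by blast
  fix n assume n: "n \<in> keys p \<and> (\<forall>m'\<in>keys p. m' \<noteq> n \<longrightarrow> grevlex lt m' n)"
  show "n = m"
  proof (rule ccontr)
    assume "n \<noteq> m"
    then have "grevlex lt n m" "grevlex lt m n" using n assms by auto
    then show False using grevlex_trans grevlex_irrefl by blast
  qed
qed

lemma lead_monom_maximal:
  assumes "p \<noteq> 0"
  shows "lead_monom (grevlex lt) p \<in> keys p"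
    and "\<And>m. m \<in> keys p \<Longrightarrow> m \<noteq> lead_monom (grevlex lt) p \<Longrightarrow>
           grevlex lt m (lead_monom (grevlex lt) p)"
proof -
  have "\<exists>m\<in>keys p. \<forall>x\<in>keys p. x \<noteq> m \<longrightarrow> \<not> grevlex lt m x"
  proof (rule Finite_Set.bex_max_element)
    show "asymp_on (keys p) (grevlex lt)"
      using grevlex_irrefl grevlex_trans by (blast intro: asymp_onI)
    show "transp_on (keys p) (grevlex lt)"
      using grevlex_trans by (blast intro: transp_onI)
  qed (use assms in auto)
  then obtain m where m: "m \<in> keys p" "\<And>x. x \<in> keys p \<Longrightarrow> x \<noteq> m \<Longrightarrow> grevlex lt x m"
    using grevlex_total by blast
  with lead_monom_eqI[OF this] show "lead_monom (grevlex lt) p \<in> keys p"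
    and "\<And>m. m \<in> keys p \<Longrightarrow> m \<noteq> lead_monom (grevlex lt) p \<Longrightarrow>
           grevlex lt m (lead_monom (grevlex lt) p)" by auto
qed

lemma keys_binomial:
  assumes "l \<noteq> r" shows "keys (xmon l - xmon r :: ('x, 'k::field) mpoly) = {l, r}"
  using assms by (auto simp: in_keys_iff lookup_minus lookup_single when_def split: if_splits)

lemma lead_monom_binomial:
  assumes "grevlex lt r l"
  shows "lead_monom (grevlex lt) (xmon l - xmon r :: ('x, 'k::field) mpoly) = l"
    and "lead_monom (grevlex lt) (xmon r - xmon l :: ('x, 'k::field) mpoly) = l"
proof -
  have "l \<noteq> r" using assms grevlex_irrefl by blast
  then show "lead_monom (grevlex lt) (xmon l - xmon r :: ('x, 'k::field) mpoly) = l"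
    "lead_monom (grevlex lt) (xmon r - xmon l :: ('x, 'k::field) mpoly) = l"
    using assms by (auto intro!: lead_monom_eqI simp: keys_binomial)
qed

end

text \<open>
  Each of the eight orders of the vertices is lexicographic, with each coordinate increasing or
  decreasing.
\<close>

lemma lexicographic_strict_total_order:
  assumes "strict_total_order p" "strict_total_order q"
    and inj: "\<And>x y. f x = f y \<Longrightarrow> g x = g y \<Longrightarrow> x = y"
  shows "strict_total_order (\<lambda>x y. p (f x) (f y) \<or> f x = f y \<and> q (g x) (g y))"
proof -
  interpret p: strict_total_order p by fact
  interpret q: strict_total_order q by fact
  show ?thesis
  proof
    show "\<not> (p (f x) (f x) \<or> f x = f x \<and> q (g x) (g x))" for x
      using p.irrefl q.irrefl by simp
    show "p (f x) (f z) \<or> f x = f z \<and> q (g x) (g z)"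
      if "p (f x) (f y) \<or> f x = f y \<and> q (g x) (g y)" "p (f y) (f z) \<or> f y = f z \<and> q (g y) (g z)"
      for x y z
      using that p.trans[of "f x" "f y" "f z"] q.trans[of "g x" "g y" "g z"] by auto
    show "(p (f x) (f y) \<or> f x = f y \<and> q (g x) (g y)) \<or> (p (f y) (f x) \<or> f y = f x \<and> q (g y) (g x))"
      if "x \<noteq> y" for x y
      using that inj[of x y] p.total[of "f x" "f y"] q.total[of "g x" "g y"]
      by (cases "f x = f y") auto
  qed
qed

lemma strict_total_order_nat:
  "strict_total_order ((<) :: nat \<Rightarrow> nat \<Rightarrow> bool)" "strict_total_order ((>) :: nat \<Rightarrow> nat \<Rightarrow> bool)"
  by (unfold_locales; auto)+

lemma vertex_less_simps:
  "vertex_less 1 = (\<lambda>a b. fst a < fst b \<or> fst a = fst b \<and> snd a > snd b)"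
  "vertex_less 2 = (\<lambda>a b. fst a > fst b \<or> fst a = fst b \<and> snd a > snd b)"
  "vertex_less 3 = (\<lambda>a b. fst a > fst b \<or> fst a = fst b \<and> snd a < snd b)"
  "vertex_less 4 = (\<lambda>a b. fst a < fst b \<or> fst a = fst b \<and> snd a < snd b)"
  "vertex_less 5 = (\<lambda>a b. snd a < snd b \<or> snd a = snd b \<and> fst a > fst b)"
  "vertex_less 6 = (\<lambda>a b. snd a < snd b \<or> snd a = snd b \<and> fst a < fst b)"
  "vertex_less 7 = (\<lambda>a b. snd a > snd b \<or> snd a = snd b \<and> fst a < fst b)"
  "vertex_less 8 = (\<lambda>a b. snd a > snd b \<or> snd a = snd b \<and> fst a > fst b)"
  unfolding vertex_less_def by simp_all

lemma vertex_less_variable_order: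
  assumes "i \<in> {1, 3, 5, 7} \<union> {2, 4, 6, 8}" shows "variable_order (vertex_less i)"
proof (rule variable_order.intro)
  note lex = lexicographic_strict_total_order
  have "strict_total_order (vertex_less 1)" "strict_total_order (vertex_less 2)"
    "strict_total_order (vertex_less 3)" "strict_total_order (vertex_less 4)"
    unfolding vertex_less_simps
    by (rule lex[of _ _ fst snd]; simp add: strict_total_order_nat prod_eq_iff)+
  moreover have "strict_total_order (vertex_less 5)" "strict_total_order (vertex_less 6)"
    "strict_total_order (vertex_less 7)" "strict_total_order (vertex_less 8)"
    unfolding vertex_less_simps
    by (rule lex[of _ _ snd fst]; simp add: strict_total_order_nat prod_eq_iff)+
  ultimately show "strict_total_order (vertex_less i)" using assms by blast
qed

section \<open>Polynomial rings and monomial ideals\<close>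

lemma poly_ring_ops [simp]:
  "p \<otimes>\<^bsub>poly_ring V\<^esub> q = p * q" "p \<oplus>\<^bsub>poly_ring V\<^esub> q = p + q" "\<zero>\<^bsub>poly_ring V\<^esub> = 0"
  by (simp_all add: poly_ring_def)

lemma poly_ring_closed:
  fixes p q :: "('x, 'k::field) mpoly"
  assumes "p \<in> carrier (poly_ring V)" "q \<in> carrier (poly_ring V)"
  shows "p + q \<in> carrier (poly_ring V)" and "p * q \<in> carrier (poly_ring V)"
proof -
  show "p + q \<in> carrier (poly_ring V)"
    using assms Poly_Mapping.keys_add[of p q] by (auto simp: poly_ring_def)
  show "p * q \<in> carrier (poly_ring V)"
    using assms Poly_Mapping.keys_mult[of p q] by (fastforce simp: poly_ring_def keys_add_monom)
qed

lemma ring_poly_ring: "ring (poly_ring V :: ('x, 'k::field) mpoly ring)"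
proof (rule ringI)
  show "abelian_group (poly_ring V :: ('x, 'k) mpoly ring)"
  proof (rule abelian_groupI)
    fix p :: "('x, 'k) mpoly" assume "p \<in> carrier (poly_ring V)"
    then show "\<exists>q\<in>carrier (poly_ring V). q \<oplus>\<^bsub>poly_ring V\<^esub> p = \<zero>\<^bsub>poly_ring V\<^esub>"
      by (intro bexI[of _ "- p"]) (auto simp: poly_ring_def in_keys_iff)
  qed (simp_all add: poly_ring_closed, simp_all add: poly_ring_def algebra_simps)
  show "monoid (poly_ring V :: ('x, 'k) mpoly ring)"
    by (rule monoidI) (simp_all add: poly_ring_closed, simp_all add: poly_ring_def algebra_simps)
qed (simp_all add: poly_ring_def algebra_simps)

lemmas poly_genideal_ideal = ring.genideal_ideal[OF ring_poly_ring]

lemmas poly_genideal_self = ring.genideal_self[OF ring_poly_ring]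

lemmas poly_genideal_minimal = ring.genideal_minimal[OF ring_poly_ring]

lemma xmon_in_poly_ring:
  "keys m \<subseteq> V \<Longrightarrow> Poly_Mapping.single m c \<in> carrier (poly_ring V)"
  by (auto simp: poly_ring_def split: if_splits)

lemma poly_ring_idealI:
  fixes J :: "('x, 'k::field) mpoly set"
  assumes "J \<subseteq> carrier (poly_ring V)" "0 \<in> J"
    and "\<And>p q. p \<in> J \<Longrightarrow> q \<in> J \<Longrightarrow> p + q \<in> J"
    and "\<And>p q. p \<in> carrier (poly_ring V) \<Longrightarrow> q \<in> J \<Longrightarrow> p * q \<in> J"
  shows "ideal J (poly_ring V)"
proof (rule idealI)
  show "subgroup J (add_monoid (poly_ring V))"
  proof
    fix p assume p: "p \<in> J"
    have "- 1 \<in> carrier (poly_ring V :: ('x, 'k) mpoly ring)"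
      by (auto simp: poly_ring_def)
    then have "- p \<in> J" using assms(4)[of "- 1" p] p by simp
    moreover have "inv\<^bsub>add_monoid (poly_ring V)\<^esub> p = - p"
    proof -
      have "\<ominus>\<^bsub>poly_ring V\<^esub> p = - p"
        using calculation p assms(1)
        by (intro abelian_group.minus_equality[OF ring.is_abelian_group[OF ring_poly_ring]]) auto
      then show ?thesis by (simp add: a_inv_def)
    qed
    ultimately show "inv\<^bsub>add_monoid (poly_ring V)\<^esub> p \<in> J" by simp
  qed (use assms in auto)
  show "p \<otimes>\<^bsub>poly_ring V\<^esub> q \<in> J" "q \<otimes>\<^bsub>poly_ring V\<^esub> p \<in> J"
    if "q \<in> J" "p \<in> carrier (poly_ring V)" for p q
    using assms(4)[OF that(2,1)] by (simp_all add: mult.commute)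
qed (rule ring_poly_ring)

lemma monom_dvd_refl: "monom_dvd u u"
  unfolding monom_dvd_def by (rule exI[of _ 0]) simp

lemma monom_ideal_keys:
  assumes "p \<in> Idl\<^bsub>poly_ring V\<^esub> (xmon ` L :: ('x, 'k::field) mpoly set)"
    and "\<And>l. l \<in> L \<Longrightarrow> keys l \<subseteq> V" and "m \<in> keys p"
  obtains l where "l \<in> L" "monom_dvd l m"
proof -
  define J where "J = {p \<in> carrier (poly_ring V :: ('x, 'k) mpoly ring).
    \<forall>m\<in>keys p. \<exists>l\<in>L. monom_dvd l m}"
  have "ideal J (poly_ring V)"
  proof (rule poly_ring_idealI)
    fix p q :: "('x, 'k) mpoly" assume "p \<in> J" "q \<in> J"
    then show "p + q \<in> J" using Poly_Mapping.keys_add[of p q] poly_ring_closed(1)[of p V q]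
      by (auto simp: J_def)
  next
    fix p q :: "('x, 'k) mpoly" assume pq: "p \<in> carrier (poly_ring V)" "q \<in> J"
    have "\<exists>l\<in>L. monom_dvd l m" if "m \<in> keys (p * q)" for m
    proof -
      obtain u v where "m = u + v" "v \<in> keys q"
        using Poly_Mapping.keys_mult[of p q] \<open>m \<in> keys (p * q)\<close> by blast
      moreover from this obtain l w where "l \<in> L" "v = l + w"
        using pq by (auto simp: J_def monom_dvd_def)
      ultimately have "l \<in> L" "m = l + (u + w)" by (simp_all add: ac_simps)
      then show ?thesis unfolding monom_dvd_def by blast
    qed
    then show "p * q \<in> J" using pq poly_ring_closed(2)[of p V q] by (auto simp: J_def)
  qed (auto simp: J_def poly_ring_def)
  moreover have "xmon ` L \<subseteq> J"
    using assms(2) by (auto simp: J_def xmon_in_poly_ring intro: monom_dvd_refl)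
  ultimately have "p \<in> J" using assms(1) poly_genideal_minimal by blast
  then show ?thesis using assms(3) that by (auto simp: J_def)
qed

section \<open>Linear functionals on polynomials\<close>

text \<open>
  The linear functional on polynomials that takes the value \<open>h m\<close> on the monomial \<open>m\<close>.
\<close>

definition pairing :: "('x monom \<Rightarrow> 'k) \<Rightarrow> ('x, 'k::field) mpoly \<Rightarrow> 'k" where
  "pairing h p = (\<Sum>m\<in>keys p. lookup p m * h m)"

lemma pairing_zero [simp]: "pairing h 0 = 0"
  by (simp add: pairing_def)

lemma pairing_add: "pairing h (p + q) = pairing h p + pairing h q"
  unfolding pairing_def
  by (rule setsum_keys_plus_distrib) (simp_all add: distrib_right)

lemma pairing_single: "pairing h (Poly_Mapping.single m c) = c * h m"
  by (simp add: pairing_def)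

lemma pairing_binomial:
  fixes h :: "'x monom \<Rightarrow> 'k::field"
  shows "pairing h (xmon l - xmon r) = h l - h r"
proof -
  have "xmon l - xmon r = xmon l + Poly_Mapping.single r (- 1 :: 'k)"
    by (simp add: single_uminus)
  then show ?thesis by (simp only: pairing_add pairing_single) simp
qed

lemma mpoly_induct [case_names zero single add]:
  fixes p :: "('x, 'k::field) mpoly"
  assumes "P 0" "\<And>m c. P (Poly_Mapping.single m c)" "\<And>p q. P p \<Longrightarrow> P q \<Longrightarrow> P (p + q)"
  shows "P p"
proof -
  have "P (\<Sum>m\<in>A. Poly_Mapping.single m (lookup p m))" for A
    using assms by (induction A rule: infinite_finite_induct) auto
  moreover have "p = (\<Sum>m\<in>keys p. Poly_Mapping.single m (lookup p m))"
    by (rule poly_mapping_eqI)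
       (auto simp: lookup_sum lookup_single when_def in_keys_iff)
  ultimately show ?thesis by metis
qed

text \<open>
  Multiplication by a monomial is adjoint to a shift of the functional.  Invariance of the
  functional under rewriting survives the shift, and this makes the common kernel of all invariant
  functionals an ideal.
\<close>

lemma pairing_shift:
  "pairing h (Poly_Mapping.single u c * q) = c * pairing (\<lambda>m. h (u + m)) q"
  by (induction q rule: mpoly_induct)
     (simp_all add: mult_single pairing_single distrib_left pairing_add)

section \<open>Termination and local confluence\<close>

lemma newman:
  assumes "wfp r\<inverse>\<inverse>"
    and local: "\<And>x y z. r x y \<Longrightarrow> r x z \<Longrightarrow> \<exists>u. r\<^sup>*\<^sup>* y u \<and> r\<^sup>*\<^sup>* z u"
  shows "confluentp r"
proof (rule confluentpI)
  show "\<exists>u. r\<^sup>*\<^sup>* y u \<and> r\<^sup>*\<^sup>* z u" if "r\<^sup>*\<^sup>* x y" "r\<^sup>*\<^sup>* x z" for x y z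
    using assms(1) that
  proof (induction x arbitrary: y z rule: wfp_induct_rule)
    case (less x)
    show ?case
    proof (cases "x = y \<or> x = z")
      case True
      then show ?thesis using less.prems by blast
    next
      case False
      then obtain y' z' where y': "r x y'" "r\<^sup>*\<^sup>* y' y" and z': "r x z'" "r\<^sup>*\<^sup>* z' z"
        using less.prems by (metis converse_rtranclpE)
      obtain u where u: "r\<^sup>*\<^sup>* y' u" "r\<^sup>*\<^sup>* z' u" using local y'(1) z'(1) by blast
      obtain v where v: "r\<^sup>*\<^sup>* y v" "r\<^sup>*\<^sup>* u v" using less.IH y' u(1) by blast
      have "r\<^sup>*\<^sup>* z' v" using u(2) v(2) by (rule rtranclp_trans)
      then obtain w where "r\<^sup>*\<^sup>* v w" "r\<^sup>*\<^sup>* z w" using less.IH z' by blast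
      then show ?thesis using v(1) rtranclp_trans by metis
    qed
  qed
qed

section \<open>Groebner bases of binomials and confluence\<close>

text \<open>
  A finite set \<open>R\<close> of rules \<open>(l, r)\<close>, each replacing the monomial \<open>l\<close> by the smaller
  monomial \<open>r\<close>, in the variables from \<open>V\<close>.  A rule stands for the binomial \<open>l - r\<close> with leading
  monomial \<open>l\<close>.
\<close>

locale binomial_rewriting = variable_order lt
  for lt :: "'x \<Rightarrow> 'x \<Rightarrow> bool" +
  fixes V :: "'x set" and R :: "('x monom \<times> 'x monom) set"
  assumes finite_R: "finite R"
    and keys_R: "(l, r) \<in> R \<Longrightarrow> keys l \<subseteq> V \<and> keys r \<subseteq> V"
    and decreasing: "(l, r) \<in> R \<Longrightarrow> grevlex lt r l"
begin

definition binomials :: "('x, 'k::field) mpoly set" where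
  "binomials = {xmon l - xmon r | l r. (l, r) \<in> R}"

text \<open>
  One rewriting step: a factor \<open>l\<close> of the monomial is replaced by \<open>r\<close>.
\<close>

definition step :: "'x monom \<Rightarrow> 'x monom \<Rightarrow> bool" where
  "step u v \<longleftrightarrow> (\<exists>l r s. (l, r) \<in> R \<and> u = l + s \<and> v = r + s)"

lemma step_add: "step u v \<Longrightarrow> step (w + u) (w + v)"
proof -
  assume "step u v"
  then obtain l r s where lr: "(l, r) \<in> R" "u = l + s" "v = r + s" unfolding step_def by blast
  then have "w + u = l + (w + s)" "w + v = r + (w + s)" by (simp_all add: ac_simps)
  then show "step (w + u) (w + v)" using lr(1) unfolding step_def by blast
qed

lemma step_less: "step u v \<Longrightarrow> grevlex lt v u"
  unfolding step_def using decreasing grevlex_add by blast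

lemma steps_less: "step\<^sup>*\<^sup>* u v \<Longrightarrow> u = v \<or> grevlex lt v u"
  by (induction rule: rtranclp_induct) (use step_less grevlex_trans in blast)+

lemma binomials_carrier: "binomials \<subseteq> carrier (poly_ring V :: ('x, 'k::field) mpoly ring)"
proof
  fix p :: "('x, 'k) mpoly" assume "p \<in> binomials"
  then obtain l r where lr: "p = xmon l - xmon r" "(l, r) \<in> R" by (auto simp: binomials_def)
  then have "l \<noteq> r" using decreasing grevlex_irrefl by blast
  then show "p \<in> carrier (poly_ring V)"
    using lr keys_R[of l r] by (auto simp: poly_ring_def keys_binomial)
qed

lemma initial_binomials:
  "initial_monom (grevlex lt) ` (binomials :: ('x, 'k::field) mpoly set) = xmon ` fst ` R"
proof -
  have "initial_monom (grevlex lt) (xmon l - xmon r :: ('x, 'k) mpoly) = xmon l"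
    if "(l, r) \<in> R" for l r
    using decreasing[OF that] by (simp add: initial_monom_def lead_monom_binomial)
  then show ?thesis by (force simp: binomials_def image_iff)
qed

lemma pairing_ideal:
  fixes p :: "('x, 'k::field) mpoly"
  assumes "p \<in> Idl\<^bsub>poly_ring V\<^esub> binomials" "\<And>u v. step u v \<Longrightarrow> h u = h v"
  shows "pairing h p = 0"
proof -
  define invariant where "invariant = {h :: 'x monom \<Rightarrow> 'k. \<forall>u v. step u v \<longrightarrow> h u = h v}"
  define J where "J = {p \<in> carrier (poly_ring V). \<forall>h\<in>invariant. pairing h p = 0}"
  have "ideal J (poly_ring V)"
  proof (rule poly_ring_idealI)
    fix p q :: "('x, 'k) mpoly" assume pq: "p \<in> carrier (poly_ring V)" "q \<in> J"
    have "pairing h (p * q) = 0" if "h \<in> invariant" for h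
    proof (induction p rule: mpoly_induct)
      case (single u c)
      have "(\<lambda>m. h (u + m)) \<in> invariant" using that step_add by (auto simp: invariant_def)
      then show ?case using pq by (simp add: pairing_shift J_def)
    qed (simp_all add: pairing_add distrib_right)
    then show "p * q \<in> J" using pq poly_ring_closed(2)[of p V q] by (auto simp: J_def)
  next
    fix p q :: "('x, 'k) mpoly" assume "p \<in> J" "q \<in> J"
    then show "p + q \<in> J" using poly_ring_closed(1)[of p V q] by (auto simp: J_def pairing_add)
  qed (auto simp: J_def poly_ring_def)
  moreover have "binomials \<subseteq> J"
  proof
    fix p assume p: "p \<in> (binomials :: ('x, 'k) mpoly set)"
    then obtain l r where lr: "p = xmon l - xmon r" "(l, r) \<in> R" by (auto simp: binomials_def)
    then have "step l r" unfolding step_def by (metis add.right_neutral)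
    then show "p \<in> J" using p binomials_carrier by (auto simp: J_def lr pairing_binomial invariant_def)
  qed
  ultimately have "p \<in> J" using poly_genideal_minimal[of J V binomials] assms(1) by blast
  then show ?thesis using assms(2) by (auto simp: J_def invariant_def)
qed

text \<open>
  If rewriting is confluent, the leading monomial \<open>m\<close> of a nonzero element of the ideal is
  reducible.  Otherwise the monomials that rewrite to \<open>m\<close> are closed under steps in both
  directions, and the functional summing the coefficients of these monomials vanishes on the ideal.
  As all of them except \<open>m\<close> are larger than \<open>m\<close>, it picks out the leading coefficient.
\<close>

lemma lead_monom_reducible:
  fixes p :: "('x, 'k::field) mpoly"
  assumes "confluentp step" and p: "p \<in> Idl\<^bsub>poly_ring V\<^esub> binomials" "p \<noteq> 0"
  obtains v where "step (lead_monom (grevlex lt) p) v"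
proof (rule ccontr)
  define m where "m = lead_monom (grevlex lt) p"
  assume "\<not> thesis"
  then have "\<nexists>v. step (lead_monom (grevlex lt) p) v" using that by blast
  then have irreducible: "u = m" if "step\<^sup>*\<^sup>* m u" for u
    using that by (metis converse_rtranclpE m_def)
  \<comment> \<open>The indicator function of the monomials that rewrite to \<open>m\<close>.\<close>
  define h :: "'x monom \<Rightarrow> 'k" where "h u = (if step\<^sup>*\<^sup>* u m then 1 else 0)" for u
  have "pairing h p = 0"
  proof (rule pairing_ideal[OF p(1)])
    fix u v assume uv: "step u v"
    have "step\<^sup>*\<^sup>* v m" if "step\<^sup>*\<^sup>* u m"
      using confluentpD[OF assms(1) r_into_rtranclp[of step, OF uv] that] irreducible by blast
    then show "h u = h v" using uv converse_rtranclp_into_rtranclp[of step] by (auto simp: h_def)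
  qed
  moreover have "pairing h p = lookup p m"
  proof -
    have "lookup p u * h u = (if u = m then lookup p u else 0)" if "u \<in> keys p" for u
    proof (cases "u = m")
      case True
      then show ?thesis by (simp add: h_def)
    next
      case False
      then have "grevlex lt u m" using lead_monom_maximal(2)[OF p(2) that] by (simp add: m_def)
      then have "\<not> grevlex lt m u" using grevlex_trans grevlex_irrefl by blast
      then have "\<not> step\<^sup>*\<^sup>* u m" using steps_less False by blast
      then show ?thesis using False by (simp add: h_def)
    qed
    then have "pairing h p = (\<Sum>u\<in>keys p. if u = m then lookup p u else 0)"
      unfolding pairing_def by (rule sum.cong[OF refl])
    also have "\<dots> = lookup p m" by (auto simp: in_keys_iff)
    finally show ?thesis .
  qed
  moreover have "m \<in> keys p" using lead_monom_maximal(1)[OF p(2)] by (simp add: m_def)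
  ultimately show False by (simp add: in_keys_iff)
qed

lemma groebner_basis_if_confluent:
  assumes "confluentp step"
  shows "groebner_basis V (grevlex lt) (Idl\<^bsub>poly_ring V\<^esub> binomials)
           (binomials :: ('x, 'k::field) mpoly set)"
proof -
  let ?B = "binomials :: ('x, 'k) mpoly set"
  let ?I = "Idl\<^bsub>poly_ring V\<^esub> ?B"
  let ?in = "initial_monom (grevlex lt) :: ('x, 'k) mpoly \<Rightarrow> _"
  have I: "ideal ?I (poly_ring V)" by (rule poly_genideal_ideal[OF binomials_carrier])
  have lead: "keys (lead_monom (grevlex lt) f) \<subseteq> V" if "f \<in> ?I" "f \<noteq> 0" for f
    using ideal.Icarr[OF I that(1)] lead_monom_maximal(1)[OF that(2)]
    by (auto simp: poly_ring_def)
  have "?B = (\<lambda>(l, r). xmon l - xmon r) ` R" by (auto simp: binomials_def)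
  then have "finite ?B" using finite_R by simp
  moreover have "?B \<subseteq> ?I - {0}"
  proof -
    have "f \<noteq> 0" if f: "f \<in> ?B" for f
    proof -
      obtain l r where lr: "f = xmon l - xmon r" "(l, r) \<in> R" using f by (auto simp: binomials_def)
      then have "l \<noteq> r" using decreasing grevlex_irrefl by blast
      then have "keys f \<noteq> {}" by (simp add: lr keys_binomial)
      then show ?thesis by auto
    qed
    then show ?thesis using poly_genideal_self[OF binomials_carrier] by auto
  qed
  moreover have "Idl\<^bsub>poly_ring V\<^esub> (?in ` ?B) = Idl\<^bsub>poly_ring V\<^esub> (?in ` (?I - {0}))"
  proof
    have "?in ` (?I - {0}) \<subseteq> carrier (poly_ring V)"
      using xmon_in_poly_ring[OF lead] by (auto simp: initial_monom_def)
    note K = poly_genideal_ideal[OF this] poly_genideal_self[OF this]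
    have "?in ` ?B \<subseteq> ?in ` (?I - {0})" using \<open>?B \<subseteq> ?I - {0}\<close> by (rule image_mono)
    then show "Idl\<^bsub>poly_ring V\<^esub> (?in ` ?B) \<subseteq> Idl\<^bsub>poly_ring V\<^esub> (?in ` (?I - {0}))"
      using K(2) by (intro poly_genideal_minimal[OF K(1)]) (rule subset_trans)
    have "?in ` ?B \<subseteq> carrier (poly_ring V)"
      unfolding initial_binomials using keys_R by (force intro: xmon_in_poly_ring)
    note J = poly_genideal_ideal[OF this] poly_genideal_self[OF this]
    have "?in f \<in> Idl\<^bsub>poly_ring V\<^esub> (?in ` ?B)" if f: "f \<in> ?I" "f \<noteq> 0" for f
    proof -
      obtain l r s where s: "(l, r) \<in> R" "lead_monom (grevlex lt) f = l + s"
        using lead_monom_reducible[OF assms f] unfolding step_def by metis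
      then have "?in f = xmon s * xmon l" by (simp add: initial_monom_def mult_single ac_simps)
      moreover have "xmon l \<in> Idl\<^bsub>poly_ring V\<^esub> (?in ` ?B)"
        using J(2) s(1) unfolding initial_binomials by force
      moreover have "xmon s \<in> carrier (poly_ring V :: ('x, 'k) mpoly ring)"
        using lead[OF f] s(2) by (intro xmon_in_poly_ring) (simp add: keys_add_monom)
      ultimately show ?thesis using ideal.I_l_closed[OF J(1)] by fastforce
    qed
    then show "Idl\<^bsub>poly_ring V\<^esub> (?in ` (?I - {0})) \<subseteq> Idl\<^bsub>poly_ring V\<^esub> (?in ` ?B)"
      by (intro poly_genideal_minimal[OF J(1)]) auto
  qed
  ultimately show ?thesis unfolding groebner_basis_def by blast
qed

text \<open>
  Conversely, two distinct results \<open>v\<close> and \<open>w\<close> of rewriting the same monomial differ by an element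
  of the ideal, whose leading monomial is \<open>v\<close> or \<open>w\<close>; for a Groebner basis this monomial is
  reducible.
\<close>

lemma groebner_basis_reduces_peak:
  assumes gb: "groebner_basis V (grevlex lt) (Idl\<^bsub>poly_ring V\<^esub> binomials)
                 (binomials :: ('x, 'k::field) mpoly set)"
    and peak: "step u v" "step u w" "v \<noteq> w" and u: "keys u \<subseteq> V"
  obtains (left) x where "step v x" | (right) x where "step w x"
proof -
  let ?B = "binomials :: ('x, 'k) mpoly set"
  have I: "ideal (Idl\<^bsub>poly_ring V\<^esub> ?B) (poly_ring V)"
    by (rule poly_genideal_ideal[OF binomials_carrier])
  have diff: "Poly_Mapping.single x c - Poly_Mapping.single y c \<in> Idl\<^bsub>poly_ring V\<^esub> ?B"
    if "step x y" "keys x \<subseteq> V" for x y c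
  proof -
    obtain l r s where s: "(l, r) \<in> R" "x = l + s" "y = r + s"
      using \<open>step x y\<close> by (auto simp: step_def)
    have "xmon l - xmon r \<in> ?B" using s(1) by (auto simp: binomials_def)
    then have "xmon l - xmon r \<in> Idl\<^bsub>poly_ring V\<^esub> ?B"
      using poly_genideal_self[OF binomials_carrier] by blast
    moreover have "Poly_Mapping.single s c \<in> carrier (poly_ring V)"
      using that(2) s(2) by (intro xmon_in_poly_ring) (simp add: keys_add_monom)
    ultimately have "Poly_Mapping.single s c * (xmon l - xmon r) \<in> Idl\<^bsub>poly_ring V\<^esub> ?B"
      using ideal.I_l_closed[OF I] by simp
    then show ?thesis by (simp add: s right_diff_distrib mult_single ac_simps)
  qed
  define f :: "('x, 'k) mpoly" where "f = xmon w - xmon v"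
  have "(xmon u - xmon v) + (Poly_Mapping.single u (- 1) - Poly_Mapping.single w (- 1))
        \<in> Idl\<^bsub>poly_ring V\<^esub> ?B"
    using additive_subgroup.a_closed[OF ideal.axioms(1)[OF I] diff diff] peak u by simp
  then have "f \<in> Idl\<^bsub>poly_ring V\<^esub> ?B" by (simp add: f_def single_uminus)
  moreover have keys_f: "keys f = {w, v}" using peak(3) by (simp add: f_def keys_binomial)
  then have "f \<noteq> 0" by auto
  moreover define m where "m = lead_monom (grevlex lt) f"
  moreover have "m \<in> {w, v}" using lead_monom_maximal(1)[OF \<open>f \<noteq> 0\<close>] keys_f m_def by simp
  moreover have in_carrier: "initial_monom (grevlex lt) ` (Idl\<^bsub>poly_ring V\<^esub> ?B - {0}) \<subseteq> carrier (poly_ring V)"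
  proof (rule image_subsetI)
    fix g assume "g \<in> Idl\<^bsub>poly_ring V\<^esub> ?B - {0}"
    then have g: "g \<in> Idl\<^bsub>poly_ring V\<^esub> ?B" "g \<noteq> 0" by auto
    then show "initial_monom (grevlex lt) g \<in> carrier (poly_ring V)"
      using ideal.Icarr[OF I] lead_monom_maximal(1)[OF g(2)]
      by (auto simp: initial_monom_def poly_ring_def)
  qed
  ultimately have "xmon m \<in> Idl\<^bsub>poly_ring V\<^esub> (initial_monom (grevlex lt) ` (Idl\<^bsub>poly_ring V\<^esub> ?B - {0}))"
    using poly_genideal_self[OF in_carrier] by (auto simp: initial_monom_def image_subset_iff)
  then have "xmon m \<in> Idl\<^bsub>poly_ring V\<^esub> (xmon ` fst ` R :: ('x, 'k) mpoly set)"
    using gb by (simp add: groebner_basis_def initial_binomials)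
  then obtain l' where "l' \<in> fst ` R" "monom_dvd l' m"
  proof (rule monom_ideal_keys)
    show "keys l' \<subseteq> V" if "l' \<in> fst ` R" for l' using that keys_R by fastforce
  qed simp_all
  then obtain l r where "(l, r) \<in> R" "monom_dvd l m" by auto
  then have "\<exists>x. step m x" by (auto simp: step_def monom_dvd_def)
  then show ?thesis using \<open>m \<in> {w, v}\<close> left right by blast
qed

end

section \<open>Two-by-two minors of a family of rectangles\<close>

text \<open>
  Unique factorization of monomials, for splitting off two distinct variables.
\<close>

lemma xvar_exchange:
  assumes "xvar a + p = xvar b + q" "a \<noteq> b"
  obtains s where "p = xvar b + s" "q = xvar a + s"
proof
  have eq: "lookup (xvar a) x + lookup p x = lookup (xvar b) x + lookup q x" for x
    using arg_cong[OF assms(1), of "\<lambda>f. lookup f x"] by (simp add: lookup_add)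
  show p: "p = xvar b + (p - xvar b)"
  proof (rule poly_mapping_eqI)
    fix x show "lookup p x = lookup (xvar b + (p - xvar b)) x"
      using eq[of x] assms(2)
      by (auto simp: lookup_add lookup_minus lookup_single when_def split: if_splits)
  qed
  show "q = xvar a + (p - xvar b)"
  proof (rule poly_mapping_eqI)
    fix x show "lookup q x = lookup (xvar a + (p - xvar b)) x"
      using eq[of x] assms(2)
      by (auto simp: lookup_add lookup_minus lookup_single when_def split: if_splits)
  qed
qed

text \<open>
  \<open>H i k j l\<close> says that the rectangle with columns from \<open>i\<close> to \<open>k\<close> and rows from \<open>j\<close> to \<open>l\<close>
  belongs to the family.  Such a rectangle gives the minor on its four corners, and the order of
  the variables is required to select the diagonal through \<open>(i, j)\<close> and \<open>(k, l)\<close> as leading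
  monomial.  The order of the rows is a parameter: its reversal exchanges diagonals and
  antidiagonals of the grid, so that both cases of the theorem are instances.  The weight \<open>wt\<close>
  only serves to prove that rewriting terminates.
\<close>

locale rectangle_family = variable_order lt + rows: linorder row_le row_less
  for lt :: "'a::linorder \<times> 'b \<Rightarrow> 'a \<times> 'b \<Rightarrow> bool"
    and row_le :: "'b \<Rightarrow> 'b \<Rightarrow> bool" (infix "\<sqsubseteq>" 50)
    and row_less :: "'b \<Rightarrow> 'b \<Rightarrow> bool" (infix "\<sqsubset>" 50) +
  fixes V :: "('a \<times> 'b) set"
    and H :: "'a \<Rightarrow> 'a \<Rightarrow> 'b \<Rightarrow> 'b \<Rightarrow> bool"
    and wt :: "'a \<times> 'b \<Rightarrow> nat"
  assumes proper: "H i k j l \<Longrightarrow> i < k \<and> j \<sqsubset> l"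
    and subrectangle: "H i k j l \<Longrightarrow> i \<le> i' \<Longrightarrow> i' < k' \<Longrightarrow> k' \<le> k \<Longrightarrow>
      j \<sqsubseteq> j' \<Longrightarrow> j' \<sqsubset> l' \<Longrightarrow> l' \<sqsubseteq> l \<Longrightarrow> H i' k' j' l'"
    and glue_columns: "H i k j l \<Longrightarrow> H k m j l \<Longrightarrow> H i m j l"
    and glue_rows: "H i k j l \<Longrightarrow> H i k l n \<Longrightarrow> H i k j n"
    and finite_V: "finite V"
    and corners: "H i k j l \<Longrightarrow> {(i, j), (k, l), (i, l), (k, j)} \<subseteq> V"
    and diagonal_leads:
      "H i k j l \<Longrightarrow> grevlex lt (xvar (i, l) + xvar (k, j)) (xvar (i, j) + xvar (k, l))"
    and diagonal_heavier: "H i k j l \<Longrightarrow> wt (i, l) + wt (k, j) < wt (i, j) + wt (k, l)"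
begin

text \<open>
  The product of the two diagonal corners is replaced by that of the two antidiagonal corners.
\<close>

definition rules :: "(('a \<times> 'b) monom \<times> ('a \<times> 'b) monom) set" where
  "rules = {(xvar (i, j) + xvar (k, l), xvar (i, l) + xvar (k, j)) | i k j l. H i k j l}"

lemma rules_iff:
  "(x, y) \<in> rules \<longleftrightarrow>
     (\<exists>i k j l. H i k j l \<and> x = xvar (i, j) + xvar (k, l) \<and> y = xvar (i, l) + xvar (k, j))"
  by (auto simp: rules_def)

sublocale binomial_rewriting lt V rules
proof
  have "rules \<subseteq> (\<lambda>(p, q). (xvar p + xvar q, xvar (fst p, snd q) + xvar (fst q, snd p))) ` (V \<times> V)"
    using corners by (fastforce simp: rules_def image_iff)
  then show "finite rules" by (rule finite_subset) (simp add: finite_V)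
  show "keys l \<subseteq> V \<and> keys r \<subseteq> V" if "(l, r) \<in> rules" for l r
    using that corners by (auto simp: rules_def keys_add_monom)
  show "grevlex lt r l" if "(l, r) \<in> rules" for l r
    using that diagonal_leads by (auto simp: rules_def)
qed

lemma stepI:
  assumes "H i k j l" "u = xvar (i, j) + xvar (k, l) + s" "v = xvar (i, l) + xvar (k, j) + s"
  shows "step u v"
  unfolding step_def rules_iff using assms by blast

lemma stepE:
  assumes "step u v"
  obtains i k j l s where "H i k j l"
    "u = xvar (i, j) + xvar (k, l) + s" "v = xvar (i, l) + xvar (k, j) + s"
  using assms unfolding step_def rules_iff by blast

lemma wfp_step: "wfp step\<inverse>\<inverse>"
proof -
  have "weight wt v < weight wt u" if "step u v" for u v
    using that by (auto elim!: stepE dest!: diagonal_heavier simp: weight_add simp del: One_nat_def)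
  then show ?thesis by (intro wfp_if_convertible_to_nat[of _ "weight wt"]) simp
qed

text \<open>
  The two monomials can be rewritten to a common one.
\<close>

definition joinable :: "('a \<times> 'b) monom \<Rightarrow> ('a \<times> 'b) monom \<Rightarrow> bool" where
  "joinable v w \<longleftrightarrow> (\<exists>x. step\<^sup>*\<^sup>* v x \<and> step\<^sup>*\<^sup>* w x)"

lemma joinable_refl: "joinable v v"
  by (auto simp: joinable_def)

lemma joinable_sym: "joinable v w \<Longrightarrow> joinable w v"
  by (auto simp: joinable_def)

lemma joinable_step: "step v w \<Longrightarrow> joinable v w"
  by (auto simp: joinable_def)

lemma joinable_step_step: "step v x \<Longrightarrow> step x w \<Longrightarrow> joinable v w"
  unfolding joinable_def by (meson r_into_rtranclp rtranclp.rtrancl_refl rtranclp_trans)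

lemma joinable_meet: "step v x \<Longrightarrow> step w x \<Longrightarrow> joinable v w"
  by (auto simp: joinable_def)

text \<open>
  Two rectangles with the corner \<open>(i, j)\<close> in common.  Either one contains the other or their union
  is L-shaped; each rectangle needed for the reductions is part of one of the two given ones, so
  that this overlap is always resolved.
\<close>

lemma joinable_common_lower_corner:
  assumes "H i k j l" "H i k' j l'"
  shows "joinable (xvar (i, l) + xvar (k, j) + (xvar (k', l') + t))
                  (xvar (i, l') + xvar (k', j) + (xvar (k, l) + t))"
  using assms
proof (induction k k' arbitrary: l l' rule: linorder_wlog)
  case (sym k k')
  then show ?case by (blast intro: joinable_sym)
next
  case (le k k')
  note H = le.prems and k = \<open>k \<le> k'\<close>
  have bounds: "i < k" "i < k'" "j \<sqsubset> l" "j \<sqsubset> l'" using H proper by blast+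
  consider "k = k'" "l = l'" | "k = k'" "l \<sqsubset> l'" | "k = k'" "l' \<sqsubset> l"
    | "k < k'" "l = l'" | "k < k'" "l \<sqsubset> l'" | "k < k'" "l' \<sqsubset> l"
    using k by (metis le_less rows.less_linear)
  then show ?case
  proof cases
    case 1
    then show ?thesis by (simp add: joinable_refl)
  next
    case 2
    have "H i k l l'" using subrectangle[OF H(2)] bounds 2 by simp
    then show ?thesis
      by (intro joinable_step stepI[of i k l l' _ "xvar (k, j) + t"]) (simp_all add: 2 ac_simps)
  next
    case 3
    have "H i k l' l" using subrectangle[OF H(1)] bounds 3 by simp
    then show ?thesis
      by (intro joinable_sym[OF joinable_step] stepI[of i k l' l _ "xvar (k, j) + t"])
         (simp_all add: 3 ac_simps)
  next
    case 4
    have "H k k' j l" using subrectangle[OF H(2)] bounds 4 by simp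
    then show ?thesis
      by (intro joinable_step stepI[of k k' j l _ "xvar (i, l) + t"]) (simp_all add: 4 ac_simps)
  next
    case 5
    have "H i k' l l'" "H k k' j l" using subrectangle[OF H(2)] bounds 5 by simp_all
    then show ?thesis
      by (intro joinable_step_step[where x = "xvar (i, l') + xvar (k', l) + (xvar (k, j) + t)"]
            stepI[of i k' l l' _ "xvar (k, j) + t"] stepI[of k k' j l _ "xvar (i, l') + t"])
         (simp_all add: ac_simps)
  next
    case 6
    have "H k k' j l'" using subrectangle[OF H(2)] bounds 6 by simp
    moreover have "H i k l' l" using subrectangle[OF H(1)] bounds 6 by simp
    ultimately show ?thesis
      by (intro joinable_meet[where x = "xvar (k, l') + xvar (k', j) + (xvar (i, l) + t)"]
            stepI[of k k' j l' _ "xvar (i, l) + t"] stepI[of i k l' l _ "xvar (k', j) + t"])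
         (simp_all add: ac_simps)
  qed
qed

text \<open>
  Two rectangles with the corner \<open>(k, l)\<close> in common: the previous situation turned by a half turn.
\<close>

lemma joinable_common_upper_corner:
  assumes "H i k j l" "H i' k j' l"
  shows "joinable (xvar (i, l) + xvar (k, j) + (xvar (i', j') + t))
                  (xvar (i', l) + xvar (k, j') + (xvar (i, j) + t))"
  using assms
proof (induction i' i arbitrary: j j' rule: linorder_wlog)
  case (sym i' i)
  then show ?case by (blast intro: joinable_sym)
next
  case (le i' i)
  note H = le.prems and i = \<open>i' \<le> i\<close>
  have bounds: "i < k" "i' < k" "j \<sqsubset> l" "j' \<sqsubset> l" using H proper by blast+
  consider "i = i'" "j = j'" | "i = i'" "j' \<sqsubset> j" | "i = i'" "j \<sqsubset> j'"
    | "i' < i" "j = j'" | "i' < i" "j' \<sqsubset> j" | "i' < i" "j \<sqsubset> j'"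
    using i by (metis le_less rows.less_linear)
  then show ?case
  proof cases
    case 1
    then show ?thesis by (simp add: joinable_refl)
  next
    case 2
    have "H i k j' j" using subrectangle[OF H(2)] bounds 2 by simp
    then show ?thesis
      by (intro joinable_step stepI[of i k j' j _ "xvar (i, l) + t"]) (simp_all add: 2 ac_simps)
  next
    case 3
    have "H i k j j'" using subrectangle[OF H(1)] bounds 3 by simp
    then show ?thesis
      by (intro joinable_sym[OF joinable_step] stepI[of i k j j' _ "xvar (i, l) + t"])
         (simp_all add: 3 ac_simps)
  next
    case 4
    have "H i' i j l" using subrectangle[OF H(2)] bounds 4 by simp
    then show ?thesis
      by (intro joinable_step stepI[of i' i j l _ "xvar (k, j) + t"]) (simp_all add: 4 ac_simps)
  next
    case 5
    have "H i' i j' l" "H i k j' j" using subrectangle[OF H(2)] bounds 5 by simp_all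
    then show ?thesis
      by (intro joinable_step_step[where x = "xvar (i', l) + xvar (i, j') + (xvar (k, j) + t)"]
            stepI[of i' i j' l _ "xvar (k, j) + t"] stepI[of i k j' j _ "xvar (i', l) + t"])
         (simp_all add: ac_simps)
  next
    case 6
    have "H i' i j' l" using subrectangle[OF H(2)] bounds 6 by simp
    moreover have "H i k j j'" using subrectangle[OF H(1)] bounds 6 by simp
    ultimately show ?thesis
      by (intro joinable_meet[where x = "xvar (i', l) + xvar (i, j') + (xvar (k, j) + t)"]
            stepI[of i' i j' l _ "xvar (k, j) + t"] stepI[of i k j j' _ "xvar (i', l) + t"])
         (simp_all add: ac_simps)
  qed
qed

text \<open>
  If two rectangles of the family touch diagonally in the vertex \<open>(k, l)\<close>, then one of the two
  remaining blocks of the rectangle spanned by them also belongs to the family.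
\<close>

definition completes_corners :: bool where
  "completes_corners \<longleftrightarrow>
     (\<forall>i k m j l n. H i k j l \<longrightarrow> H k m l n \<longrightarrow> H i k l n \<or> H k m j l)"

text \<open>
  The overlap of two rectangles touching in \<open>(k, l)\<close> is the only one that needs a hypothesis.
\<close>

lemma joinable_touching:
  assumes "completes_corners" and H: "H i k j l" "H k m l n"
  shows "joinable (xvar (i, l) + xvar (k, j) + (xvar (m, n) + t))
                  (xvar (k, n) + xvar (m, l) + (xvar (i, j) + t))"
proof -
  consider "H i k l n" | "H k m j l" using assms unfolding completes_corners_def by blast
  then show ?thesis
  proof cases
    case 1
    have "H i m l n" "H i k j n" using glue_columns[OF 1 H(2)] glue_rows[OF H(1) 1] .
    then show ?thesis
      by (intro joinable_meet[where x = "xvar (i, n) + xvar (m, l) + (xvar (k, j) + t)"]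
            stepI[of i m l n _ "xvar (k, j) + t"] stepI[of i k j n _ "xvar (m, l) + t"])
         (simp_all add: ac_simps)
  next
    case 2
    have "H k m j n" "H i m j l" using glue_rows[OF 2 H(2)] glue_columns[OF H(1) 2] .
    then show ?thesis
      by (intro joinable_meet[where x = "xvar (k, n) + xvar (m, j) + (xvar (i, l) + t)"]
            stepI[of k m j n _ "xvar (i, l) + t"] stepI[of i m j l _ "xvar (k, n) + t"])
         (simp_all add: ac_simps)
  qed
qed

text \<open>
  The two reductions of \<open>u\<close> replace the products of two diagonal pairs.  These pairs share their
  lower or their upper corner, or the rectangles touch, or the pairs are disjoint and the two
  reductions commute.
\<close>

lemma locally_confluent:
  assumes "completes_corners" and "step u v" "step u w"
  obtains x where "step\<^sup>*\<^sup>* v x" "step\<^sup>*\<^sup>* w x"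
proof -
  obtain i k j l s where H: "H i k j l"
    and u: "u = xvar (i, j) + xvar (k, l) + s" and v: "v = xvar (i, l) + xvar (k, j) + s"
    using assms(2) by (rule stepE)
  obtain i' k' j' l' s' where H': "H i' k' j' l'"
    and u': "u = xvar (i', j') + xvar (k', l') + s'" and w: "w = xvar (i', l') + xvar (k', j') + s'"
    using assms(3) by (rule stepE)
  have bounds: "i < k" "j \<sqsubset> l" "i' < k'" "j' \<sqsubset> l'" using proper H H' by blast+
  have eq: "xvar (i, j) + (xvar (k, l) + s) = xvar (i', j') + (xvar (k', l') + s')"
    using u u' by (simp add: ac_simps)
  consider (lower) "(i, j) = (i', j')" | (upper) "(k, l) = (k', l')" | (touch) "(k, l) = (i', j')"
    | (touch') "(i, j) = (k', l')"
    | (disjoint) "(i, j) \<noteq> (i', j')" "(k, l) \<noteq> (k', l')" "(k, l) \<noteq> (i', j')" "(i, j) \<noteq> (k', l')"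
    by blast
  then have "joinable v w"
  proof cases
    case lower
    then have eq': "xvar (k, l) + s = xvar (k', l') + s'" using eq by simp
    show ?thesis
    proof (cases "(k, l) = (k', l')")
      case True
      then show ?thesis using eq' lower v w by (simp add: joinable_refl)
    next
      case False
      then obtain t where "s = xvar (k', l') + t" "s' = xvar (k, l) + t"
        using xvar_exchange[OF eq'] by blast
      then show ?thesis using joinable_common_lower_corner[of i k j l k' l' t] H H' lower v w by simp
    qed
  next
    case upper
    have "xvar (k, l) + (xvar (i, j) + s) = xvar (k', l') + (xvar (i', j') + s')"
      using eq by (simp only: add.left_commute[of "xvar (k, l)" _ s] add.left_commute[of "xvar (k', l')" _ s'])
    then have eq': "xvar (i, j) + s = xvar (i', j') + s'" using upper by simp
    show ?thesis
    proof (cases "(i, j) = (i', j')")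
      case True
      then show ?thesis using eq' upper v w by (simp add: joinable_refl)
    next
      case False
      then obtain t where "s = xvar (i', j') + t" "s' = xvar (i, j) + t"
        using xvar_exchange[OF eq'] by blast
      then show ?thesis using joinable_common_upper_corner[of i k j l i' j' t] H H' upper v w by simp
    qed
  next
    case touch
    have "xvar (k, l) + (xvar (i, j) + s) = xvar (i', j') + (xvar (k', l') + s')"
      using eq by (simp only: add.left_commute[of "xvar (k, l)" _ s])
    then have eq': "xvar (i, j) + s = xvar (k', l') + s'" using touch by simp
    have "(i, j) \<noteq> (k', l')" using touch bounds by auto
    then obtain t where "s = xvar (k', l') + t" "s' = xvar (i, j) + t"
      using xvar_exchange[OF eq'] by blast
    then show ?thesis using joinable_touching[OF assms(1), of i k j l k' l' t] H H' touch v w by simp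
  next
    case touch'
    have "xvar (i, j) + (xvar (k, l) + s) = xvar (k', l') + (xvar (i', j') + s')"
      using eq by (simp only: add.left_commute[of "xvar (k', l')" _ s'])
    then have eq': "xvar (k, l) + s = xvar (i', j') + s'" using touch' by simp
    have "(k, l) \<noteq> (i', j')" using touch' bounds by auto
    then obtain t where "s = xvar (i', j') + t" "s' = xvar (k, l) + t"
      using xvar_exchange[OF eq'] by blast
    then have "joinable w v"
      using joinable_touching[OF assms(1), of i' k' j' l' k l t] H H' touch' v w by simp
    then show ?thesis by (rule joinable_sym)
  next
    case disjoint
    obtain t1 where t1: "xvar (k, l) + s = xvar (i', j') + t1" "xvar (k', l') + s' = xvar (i, j) + t1"
      using xvar_exchange[OF eq disjoint(1)] by blast
    obtain t2 where t2: "s = xvar (i', j') + t2" "t1 = xvar (k, l) + t2"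
      using xvar_exchange[OF t1(1) disjoint(3)] by blast
    obtain t3 where t3: "s' = xvar (i, j) + t3" "t1 = xvar (k', l') + t3"
      using xvar_exchange[OF t1(2) disjoint(4)[symmetric]] by blast
    have eq': "xvar (k, l) + t2 = xvar (k', l') + t3" using t2 t3 by simp
    obtain t where t: "t2 = xvar (k', l') + t" "t3 = xvar (k, l) + t"
      using xvar_exchange[OF eq' disjoint(2)] by blast
    let ?x = "xvar (i, l) + xvar (k, j) + (xvar (i', l') + xvar (k', j') + t)"
    have "step v ?x"
      by (rule stepI[OF H', of _ "xvar (i, l) + xvar (k, j) + t"])
         (simp_all add: v t2 t ac_simps)
    moreover have "step w ?x"
      by (rule stepI[OF H, of _ "xvar (i', l') + xvar (k', j') + t"])
         (simp_all add: w t3 t ac_simps)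
    ultimately show ?thesis by (rule joinable_meet)
  qed
  then show ?thesis using that unfolding joinable_def by blast
qed

lemma reducible_triple:
  assumes "step (xvar p + xvar q + xvar r) x"
  obtains i k j l where "H i k j l" "(i, j) \<in> {p, q, r}" "(k, l) \<in> {p, q, r}"
proof -
  obtain i k j l s where H: "H i k j l"
    and eq: "xvar p + xvar q + xvar r = xvar (i, j) + xvar (k, l) + s"
    using assms by (rule stepE)
  have "keys (xvar p + xvar q + xvar r) = {p, q, r}" by (auto simp: keys_add_monom)
  then have "{(i, j), (k, l)} \<subseteq> {p, q, r}" unfolding eq by (auto simp: keys_add_monom)
  then show ?thesis using H that by blast
qed

text \<open>
  One of the two reductions of the product of the variables at \<open>(i, j)\<close>, \<open>(k, l)\<close> and \<open>(m, n)\<close>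
  must be reducible.  The only two factors of such a reduction that can be the diagonal corners of
  a rectangle span one that contains one of the two missing blocks.
\<close>

lemma completes_corners_if_groebner:
  assumes "groebner_basis V (grevlex lt) (Idl\<^bsub>poly_ring V\<^esub> binomials)
             (binomials :: ('a \<times> 'b, 'k::field) mpoly set)"
  shows "completes_corners"
  unfolding completes_corners_def
proof (intro allI impI)
  fix i k m j l n assume H: "H i k j l" "H k m l n"
  have bounds: "i < k" "k < m" "j \<sqsubset> l" "l \<sqsubset> n" using H proper by blast+
  let ?u = "xvar (i, j) + xvar (k, l) + xvar (m, n)"
  let ?v = "xvar (i, l) + xvar (k, j) + xvar (m, n)"
  let ?w = "xvar (k, n) + xvar (m, l) + xvar (i, j)"
  have "step ?u ?v" using H(1) by (rule stepI) (rule refl)+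
  moreover have "step ?u ?w" using H(2) by (rule stepI) (simp_all add: ac_simps)
  moreover have "?v \<noteq> ?w"
  proof
    assume "?v = ?w"
    then have "keys ?v = keys ?w" by simp
    then show False using bounds by (auto simp: keys_add_monom)
  qed
  moreover have "keys ?u \<subseteq> V" using corners H by (auto simp: keys_add_monom)
  ultimately have "H i m l n \<or> H k m j n \<or> H i k j n \<or> H i m j l"
  proof (cases rule: groebner_basis_reduces_peak[OF assms, consumes 4, case_names left right])
    case (left x)
    then obtain p q r t where pq: "H p q r t" "(p, r) \<in> {(i, l), (k, j), (m, n)}"
      "(q, t) \<in> {(i, l), (k, j), (m, n)}" by (rule reducible_triple)
    have "p < q" "r \<sqsubset> t" using proper pq(1) by blast+
    then show ?thesis using pq bounds by (auto dest: less_asym rows.less_asym)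
  next
    case (right x)
    then obtain p q r t where pq: "H p q r t" "(p, r) \<in> {(k, n), (m, l), (i, j)}"
      "(q, t) \<in> {(k, n), (m, l), (i, j)}" by (rule reducible_triple)
    have "p < q" "r \<sqsubset> t" using proper pq(1) by blast+
    then show ?thesis using pq bounds by (auto dest: less_asym rows.less_asym)
  qed
  moreover have "i \<le> k" "k \<le> m" "j \<sqsubseteq> l" "l \<sqsubseteq> n"
    using bounds by (simp_all add: rows.less_imp_le)
  ultimately show "H i k l n \<or> H k m j l"
    using subrectangle[of i m l n i k l n] subrectangle[of k m j n k m j l]
      subrectangle[of i k j n i k l n] subrectangle[of i m j l k m j l] bounds by auto
qed

text \<open>
  The leading monomial of one minor occurs in no other minor, since a rectangle is determined by
  its diagonal corners, and a diagonal pair is never an antidiagonal pair.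
\<close>

lemma binomials_reduced:
  assumes "g \<in> binomials" "h \<in> binomials" "g \<noteq> h" "m \<in> keys (h :: ('a \<times> 'b, 'k::field) mpoly)"
  shows "\<not> monom_dvd (lead_monom (grevlex lt) g) m"
proof
  obtain i k j l where H: "H i k j l"
    and g: "g = xmon (xvar (i, j) + xvar (k, l)) - xmon (xvar (i, l) + xvar (k, j))"
    using assms(1) by (auto simp: binomials_def rules_iff)
  obtain i' k' j' l' where H': "H i' k' j' l'"
    and h: "h = xmon (xvar (i', j') + xvar (k', l')) - xmon (xvar (i', l') + xvar (k', j'))"
    using assms(2) by (auto simp: binomials_def rules_iff)
  have bounds: "i < k" "j \<sqsubset> l" "i' < k'" "j' \<sqsubset> l'" using proper H H' by blast+
  assume "monom_dvd (lead_monom (grevlex lt) g) m"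
  then obtain s where "m = xvar (i, j) + xvar (k, l) + s"
    unfolding g lead_monom_binomial(1)[OF diagonal_leads[OF H]] monom_dvd_def by blast
  then have ijkl: "{(i, j), (k, l)} \<subseteq> keys m" by (auto simp: keys_add_monom)
  have "xvar (i', j') + xvar (k', l') \<noteq> xvar (i', l') + xvar (k', j')"
    using diagonal_leads[OF H'] grevlex_irrefl by metis
  then have "m = xvar (i', j') + xvar (k', l') \<or> m = xvar (i', l') + xvar (k', j')"
    using assms(4) unfolding h by (simp add: keys_binomial)
  then show False
  proof
    assume "m = xvar (i', j') + xvar (k', l')"
    then have "{(i, j), (k, l)} \<subseteq> {(i', j'), (k', l')}" using ijkl by (auto simp: keys_add_monom)
    then have "(i, j) = (i', j')" "(k, l) = (k', l')" using bounds by auto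
    then show False using assms(3) g h by simp
  next
    assume "m = xvar (i', l') + xvar (k', j')"
    then have "{(i, j), (k, l)} \<subseteq> {(i', l'), (k', j')}" using ijkl by (auto simp: keys_add_monom)
    moreover have "\<not> l' \<sqsubset> j'" "\<not> k' < i'" using bounds rows.less_asym by auto
    ultimately show False using bounds by auto
  qed
qed

theorem reduced_groebner_basis_iff:
  "reduced_groebner_basis V (grevlex lt) (Idl\<^bsub>poly_ring V\<^esub> binomials)
     (binomials :: ('a \<times> 'b, 'k::field) mpoly set) \<longleftrightarrow> completes_corners"
proof
  assume "reduced_groebner_basis V (grevlex lt) (Idl\<^bsub>poly_ring V\<^esub> binomials)
     (binomials :: ('a \<times> 'b, 'k) mpoly set)"
  then show completes_corners
    using completes_corners_if_groebner unfolding reduced_groebner_basis_def by blast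
next
  assume "completes_corners"
  then have "confluentp step"
    using newman[OF wfp_step] locally_confluent by metis
  then have "groebner_basis V (grevlex lt) (Idl\<^bsub>poly_ring V\<^esub> binomials)
     (binomials :: ('a \<times> 'b, 'k) mpoly set)" by (rule groebner_basis_if_confluent)
  moreover have "lead_coef (grevlex lt) g = 1" if g: "g \<in> (binomials :: ('a \<times> 'b, 'k) mpoly set)" for g
  proof -
    obtain l r where lr: "g = xmon l - xmon r" "(l, r) \<in> rules" using g by (auto simp: binomials_def)
    then have "grevlex lt r l" "l \<noteq> r" using decreasing grevlex_irrefl by blast+
    then show ?thesis
      by (simp add: lr lead_coef_def lead_monom_binomial lookup_minus lookup_single)
  qed
  ultimately show "reduced_groebner_basis V (grevlex lt) (Idl\<^bsub>poly_ring V\<^esub> binomials)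
     (binomials :: ('a \<times> 'b, 'k) mpoly set)"
    using binomials_reduced unfolding reduced_groebner_basis_def by blast
qed

end

section \<open>Inner intervals of a polyomino\<close>

lemma cell_subset_iff:
  "cell (r, s) \<subseteq> {(i, j)..(k, l)} \<longleftrightarrow> i \<le> r \<and> r < k \<and> j \<le> s \<and> s < l"
  unfolding cell_def by (subst atLeastatMost_subset_iff) auto

lemma inner_interval_iff:
  "inner_interval P (i, j) (k, l) \<longleftrightarrow>
     i < k \<and> j < l \<and> (\<forall>r s. i \<le> r \<and> r < k \<and> j \<le> s \<and> s < l \<longrightarrow> cell (r, s) \<in> P)"
  by (auto simp: inner_interval_def proper_interval_def cell_subset_iff)

lemma inner_subinterval:
  assumes "inner_interval P (i, j) (k, l)"
    and "i \<le> i'" "i' < k'" "k' \<le> k" "j \<le> j'" "j' < l'" "l' \<le> l"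
  shows "inner_interval P (i', j') (k', l')"
  using assms by (simp add: inner_interval_iff)

lemma inner_interval_glue_columns:
  assumes "inner_interval P (i, j) (k, l)" "inner_interval P (k, j) (m, l)"
  shows "inner_interval P (i, j) (m, l)"
  using assms unfolding inner_interval_iff by (metis leI less_trans)

lemma inner_interval_glue_rows:
  assumes "inner_interval P (i, j) (k, l)" "inner_interval P (i, l) (k, n)"
  shows "inner_interval P (i, j) (k, n)"
  using assms unfolding inner_interval_iff by (metis leI less_trans)

lemma inner_interval_corners:
  assumes "inner_interval P (i, j) (k, l)"
  shows "{(i, j), (k, l), (i, l), (k, j)} \<subseteq> vertices P"
proof -
  have mem: "v \<in> vertices P" if "cell (r, s) \<in> P" "v \<in> cell (r, s)" for v r s
    using that by (auto simp: vertices_def)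
  have less: "i < k" "j < l" and P: "\<And>r s. i \<le> r \<Longrightarrow> r < k \<Longrightarrow> j \<le> s \<Longrightarrow> s < l \<Longrightarrow> cell (r, s) \<in> P"
    using assms by (auto simp: inner_interval_iff)
  have "cell (i, j) \<in> P" "cell (k - 1, l - 1) \<in> P" "cell (i, l - 1) \<in> P" "cell (k - 1, j) \<in> P"
    using less by (auto intro!: P)
  from this[THEN mem] show ?thesis using less by (simp add: cell_def)
qed

lemma finite_vertices:
  assumes "polyomino P" shows "finite (vertices P)"
proof -
  have "finite (cell a)" for a
    by (simp add: cell_def atLeastAtMost_prod_eq)
  moreover have "finite P" "P \<subseteq> range cell" using assms by (auto simp: polyomino_def)
  ultimately show ?thesis unfolding vertices_def by (intro finite_Union) auto
qed

lemma antidiagonal_pair_iff: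
  "antidiagonal_pair P {(i, l), (k, j)} \<longleftrightarrow>
     inner_interval P (i, j) (k, l) \<or> inner_interval P (k, l) (i, j)"
  by (auto simp: antidiagonal_pair_def upper_left_def lower_right_def doubleton_eq_iff)

text \<open>
  The monomial containing the smallest of the four corners is not the leading one.
\<close>

lemma grevlex_corners:
  fixes a b c d :: vertex
  assumes "variable_order lt" "lt c a" "lt c b" "lt c d"
  shows "grevlex lt (xvar c + xvar d) (xvar a + xvar b)"
    and "grevlex lt (xvar d + xvar c) (xvar a + xvar b)"
proof -
  interpret variable_order lt by fact
  show "grevlex lt (xvar c + xvar d) (xvar a + xvar b)"
    using assms by (intro grevlex_smallest_variable)
       (auto simp: monom_degree_add keys_add_monom simp del: One_nat_def)
  then show "grevlex lt (xvar d + xvar c) (xvar a + xvar b)" by (simp only: add.commute)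
qed

lemma rearrangement:
  fixes a b c d :: nat
  assumes "a < b" "c < d"
  shows "a * d + b * c < a * c + b * d"
proof -
  obtain p where p: "b = a + Suc p" using less_imp_add_positive[OF assms(1)] gr0_conv_Suc by metis
  obtain q where q: "d = c + Suc q" using less_imp_add_positive[OF assms(2)] gr0_conv_Suc by metis
  show ?thesis by (simp add: p q algebra_simps)
qed

text \<open>
  In the orders 1 and 7 the smallest corner of an interval is the upper left one, in the orders 3
  and 5 it is the lower right one, so that the diagonal corners form the leading monomial.
\<close>

lemma diagonal_rectangle_family:
  assumes "polyomino P" and i: "i \<in> {1, 3, 5, 7}"
  shows "rectangle_family (vertex_less i) (\<le>) (<) (vertices P)
           (\<lambda>i k j l. inner_interval P (i, j) (k, l)) (\<lambda>v. fst v * snd v)"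
proof (intro rectangle_family.intro rectangle_family_axioms.intro)
  show order: "variable_order (vertex_less i)" using i by (intro vertex_less_variable_order) blast
  show "class.linorder (\<le>) ((<) :: nat \<Rightarrow> nat \<Rightarrow> bool)" by (rule linorder_axioms)
  show "finite (vertices P)" using assms(1) by (rule finite_vertices)
  fix a b c d :: nat assume H: "inner_interval P (a, c) (b, d)"
  show less: "a < b \<and> c < d" using H by (simp add: inner_interval_iff)
  show "{(a, c), (b, d), (a, d), (b, c)} \<subseteq> vertices P" using H by (rule inner_interval_corners)
  have "(\<forall>v\<in>{(a, c), (b, d), (b, c)}. vertex_less i (a, d) v) \<or>
    (\<forall>v\<in>{(a, c), (b, d), (a, d)}. vertex_less i (b, c) v)"
    using i less by (elim insertE emptyE; simp only: vertex_less_simps; simp)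
  then show "grevlex (vertex_less i) (xvar (a, d) + xvar (b, c)) (xvar (a, c) + xvar (b, d))"
    by (elim disjE) (simp_all add: grevlex_corners[OF order] del: One_nat_def)
  show "fst (a, d) * snd (a, d) + fst (b, c) * snd (b, c) < fst (a, c) * snd (a, c) + fst (b, d) * snd (b, d)"
    using less rearrangement[of a b c d] by simp
  show "inner_interval P (a', c') (b', d')"
    if "a \<le> a'" "a' < b'" "b' \<le> b" "c \<le> c'" "c' < d'" "d' \<le> d" for a' b' c' d'
    using H that by (rule inner_subinterval)
  show "inner_interval P (a, c) (m, d)" if "inner_interval P (b, c) (m, d)" for m
    using H that by (rule inner_interval_glue_columns)
  show "inner_interval P (a, c) (b, n)" if "inner_interval P (a, d) (b, n)" for n
    using H that by (rule inner_interval_glue_rows)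
qed

text \<open>
  In the orders 4 and 6 the smallest corner of an interval is the lower left one, in the orders 2
  and 8 it is the upper right one, so that the antidiagonal corners form the leading monomial.
  They become the diagonal corners when the rows are reversed; the weight counts the rows from the
  top accordingly.
\<close>

lemma antidiagonal_rectangle_family:
  assumes "polyomino P" and i: "i \<in> {2, 4, 6, 8}"
  shows "rectangle_family (vertex_less i) (\<ge>) (>) (vertices P)
           (\<lambda>i k j l. inner_interval P (i, l) (k, j))
           (\<lambda>v. fst v * (Max (snd ` vertices P) - snd v))"
proof (intro rectangle_family.intro rectangle_family_axioms.intro)
  show order: "variable_order (vertex_less i)" using i by (intro vertex_less_variable_order) blast
  show "class.linorder (\<ge>) ((>) :: nat \<Rightarrow> nat \<Rightarrow> bool)" by (rule dual_linorder)
  show fin: "finite (vertices P)" using assms(1) by (rule finite_vertices)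
  fix a b c d :: nat assume H: "inner_interval P (a, d) (b, c)"
  show less: "a < b \<and> c > d" using H by (simp add: inner_interval_iff)
  show "{(a, c), (b, d), (a, d), (b, c)} \<subseteq> vertices P" using inner_interval_corners[OF H] by auto
  have "(\<forall>v\<in>{(a, c), (b, d), (b, c)}. vertex_less i (a, d) v) \<or>
    (\<forall>v\<in>{(a, c), (b, d), (a, d)}. vertex_less i (b, c) v)"
    using i less by (elim insertE emptyE; simp only: vertex_less_simps; simp)
  then show "grevlex (vertex_less i) (xvar (a, d) + xvar (b, c)) (xvar (a, c) + xvar (b, d))"
    by (elim disjE) (simp_all add: grevlex_corners[OF order] del: One_nat_def)
  define N where "N = Max (snd ` vertices P)"
  have "(b, c) \<in> vertices P" using inner_interval_corners[OF H] by simp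
  then have "c \<le> N" using fin by (force simp: N_def intro: Max_ge)
  then have "N - c < N - d" using less by linarith
  then show "fst (a, d) * (Max (snd ` vertices P) - snd (a, d)) + fst (b, c) * (Max (snd ` vertices P) - snd (b, c))
    < fst (a, c) * (Max (snd ` vertices P) - snd (a, c)) + fst (b, d) * (Max (snd ` vertices P) - snd (b, d))"
    using less rearrangement[of a b "N - c" "N - d"] by (simp add: N_def[symmetric])
  show "inner_interval P (a', d') (b', c')"
    if "a \<le> a'" "a' < b'" "b' \<le> b" "c \<ge> c'" "c' > d'" "d' \<ge> d" for a' b' c' d'
    by (rule inner_subinterval[OF H]) (use that in auto)
  show "inner_interval P (a, d) (m, c)" if "inner_interval P (b, d) (m, c)" for m
    using H that by (rule inner_interval_glue_columns)
  show "inner_interval P (a, n) (b, c)" if "inner_interval P (a, n) (b, d)" for n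
    using that H by (rule inner_interval_glue_rows)
qed

section \<open>Inner minors as oriented binomials\<close>

lemma var_times_var:
  "var a * var b = (xmon (xvar a + xvar b) :: ('x, 'k::field) mpoly)"
  by (simp add: var_def mult_single)

lemma inner_minors_eq:
  "inner_minors P = {xmon (xvar (i, j) + xvar (k, l)) - xmon (xvar (i, l) + xvar (k, j)) :: (vertex, 'k::field) mpoly
     | i k j l. inner_interval P (i, j) (k, l)}"
  unfolding inner_minors_def var_times_var upper_left_def lower_right_def by force

lemma (in rectangle_family) binomials_eq:
  "binomials = {xmon (xvar (i, j) + xvar (k, l)) - xmon (xvar (i, l) + xvar (k, j)) | i k j l. H i k j l}"
  unfolding binomials_def rules_iff by blast

lemma genideal_uminus:
  fixes B :: "('x, 'k::field) mpoly set"
  shows "Idl\<^bsub>poly_ring V\<^esub> (uminus ` B) = Idl\<^bsub>poly_ring V\<^esub> B"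
proof -
  have "uminus ` B \<subseteq> J \<longleftrightarrow> B \<subseteq> J" if J: "ideal J (poly_ring V)" for J :: "('x, 'k) mpoly set"
  proof -
    have "- p \<in> J" if "p \<in> J" for p
    proof -
      have "- 1 \<in> carrier (poly_ring V :: ('x, 'k) mpoly ring)" by (simp add: poly_ring_def)
      then show ?thesis using ideal.I_l_closed[OF J that] by fastforce
    qed
    note neg = this
    have "B \<subseteq> J" if "uminus ` B \<subseteq> J"
    proof
      fix p assume "p \<in> B"
      then have "- p \<in> J" using that by blast
      then show "p \<in> J" using neg[of "- p"] by simp
    qed
    then show ?thesis using neg by blast
  qed
  then show ?thesis unfolding genideal_def by blast
qed

context binomial_rewriting
begin

text \<open>
  Changing signs to make the leading coefficients \<open>1\<close> turns the minors into the oriented binomials,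
  also in characteristic 2, where no sign is changed.
\<close>

lemma normalized_sign:
  fixes M :: "('x, 'k::field) mpoly set"
  assumes "M = binomials \<or> M = uminus ` binomials"
  shows "(\<lambda>f. if lead_coef (grevlex lt) f = 1 then f else - f) ` M = binomials"
proof -
  define N where "N f = (if lead_coef (grevlex lt) f = 1 then f else - f)" for f :: "('x, 'k) mpoly"
  have "N f = f \<and> N (- f) = f" if f: "f \<in> binomials" for f
  proof -
    obtain l r where lr: "f = xmon l - xmon r" "(l, r) \<in> R" using f by (auto simp: binomials_def)
    then have less: "grevlex lt r l" "l \<noteq> r" using decreasing grevlex_irrefl by blast+
    then have "lead_coef (grevlex lt) f = 1" "lead_coef (grevlex lt) (- f) = - 1"
      by (simp_all add: lr lead_coef_def lead_monom_binomial lookup_minus lookup_single)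
    moreover have "- f = f" if "- 1 = (1 :: 'k)"
    proof (rule poly_mapping_eqI)
      fix m
      have "- lookup f m = - 1 * lookup f m" by simp
      also have "\<dots> = lookup f m" unfolding that by simp
      finally show "lookup (- f) m = lookup f m" by simp
    qed
    ultimately show ?thesis by (simp add: N_def)
  qed
  then show ?thesis using assms unfolding N_def[symmetric, abs_def] by (force simp: image_iff)
qed

end

lemma minors_form_reduced_gb_iff_odd:
  assumes P: "polyomino P" and i: "i \<in> {1, 3, 5, 7}"
  shows "minors_form_reduced_gb TYPE('k::field) (grevlex (vertex_less i)) P \<longleftrightarrow>
        (\<forall>a b e. inner_interval P a b \<longrightarrow> inner_interval P b e \<longrightarrow>
           inner_interval P a (upper_left b e) \<or> inner_interval P a (lower_right b e))"
proof -
  interpret rectangle_family "vertex_less i" "(\<le>)" "(<)" "vertices P"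
    "\<lambda>i k j l. inner_interval P (i, j) (k, l)" "\<lambda>v. fst v * snd v"
    using P i by (rule diagonal_rectangle_family)
  have "(inner_minors P :: (vertex, 'k) mpoly set) = binomials"
    unfolding inner_minors_eq binomials_eq ..
  then have "minors_form_reduced_gb TYPE('k) (grevlex (vertex_less i)) P \<longleftrightarrow> completes_corners"
    using reduced_groebner_basis_iff[where 'k = 'k] normalized_sign[where 'k = 'k]
    unfolding minors_form_reduced_gb_def polyomino_ideal_def signed_inner_minors_def by simp
  also have "\<dots> \<longleftrightarrow> (\<forall>a b e. inner_interval P a b \<longrightarrow> inner_interval P b e \<longrightarrow>
           inner_interval P a (upper_left b e) \<or> inner_interval P a (lower_right b e))"
  proof -
    \<comment> \<open>An interval from \<open>a\<close> is inner as soon as its part outside \<open>[a, b]\<close> is.\<close>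
    have "inner_interval P (a, c) (b, f) \<longleftrightarrow> inner_interval P (a, d) (b, f)"
      "inner_interval P (a, c) (e, d) \<longleftrightarrow> inner_interval P (b, c) (e, d)"
      if "inner_interval P (a, c) (b, d)" "inner_interval P (b, d) (e, f)" for a b c d e f
      using that inner_interval_glue_rows[of P a c b d f] inner_interval_glue_columns[of P a c b d e]
        inner_subinterval[of P a c b f a b d f] inner_subinterval[of P a c e d b e c d]
      by (auto simp: inner_interval_iff[of P a c b d] inner_interval_iff[of P b d e f])
    then show ?thesis
      unfolding completes_corners_def split_paired_All upper_left_def lower_right_def fst_conv snd_conv
      by meson
  qed
  finally show ?thesis .
qed

lemma minors_form_reduced_gb_iff_even:
  assumes P: "polyomino P" and i: "i \<in> {2, 4, 6, 8}"
  shows "minors_form_reduced_gb TYPE('k::field) (grevlex (vertex_less i)) P \<longleftrightarrow>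
        (\<forall>a b e f d. inner_interval P a b \<longrightarrow> inner_interval P e f \<longrightarrow>
           (d = lower_right a b \<and> d = upper_left e f \<or>
            d = lower_right e f \<and> d = upper_left a b) \<longrightarrow>
           antidiagonal_pair P {a, e} \<or> antidiagonal_pair P {b, f})"
proof -
  interpret rectangle_family "vertex_less i" "(\<ge>)" "(>)" "vertices P"
    "\<lambda>i k j l. inner_interval P (i, l) (k, j)" "\<lambda>v. fst v * (Max (snd ` vertices P) - snd v)"
    using P i by (rule antidiagonal_rectangle_family)
  \<comment> \<open>The leading term of an inner minor is now the subtracted one.\<close>
  have "(inner_minors P :: (vertex, 'k) mpoly set) = uminus ` binomials"
  proof (rule Set.set_eqI)
    fix f :: "(vertex, 'k) mpoly"
    have "f \<in> uminus ` binomials \<longleftrightarrow> - f \<in> binomials"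
    proof
      assume "- f \<in> binomials"
      then have "- (- f) \<in> uminus ` binomials" by (rule imageI)
      then show "f \<in> uminus ` binomials" by simp
    qed auto
    moreover have "- f = x - y \<longleftrightarrow> f = y - x" for x y by (simp add: minus_equation_iff[of f] eq_commute)
    ultimately show "f \<in> inner_minors P \<longleftrightarrow> f \<in> uminus ` binomials"
      unfolding inner_minors_eq binomials_eq by auto
  qed
  then have "minors_form_reduced_gb TYPE('k) (grevlex (vertex_less i)) P \<longleftrightarrow> completes_corners"
    using reduced_groebner_basis_iff[where 'k = 'k] normalized_sign[where 'k = 'k]
    unfolding minors_form_reduced_gb_def polyomino_ideal_def signed_inner_minors_def
    by (simp add: genideal_uminus)
  also have "\<dots> \<longleftrightarrow> (\<forall>a b e f d. inner_interval P a b \<longrightarrow> inner_interval P e f \<longrightarrow>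
           (d = lower_right a b \<and> d = upper_left e f \<or>
            d = lower_right e f \<and> d = upper_left a b) \<longrightarrow>
           antidiagonal_pair P {a, e} \<or> antidiagonal_pair P {b, f})" (is "_ \<longleftrightarrow> ?rhs")
  proof
    assume C: completes_corners
    \<comment> \<open>Both orders of the pairs are listed, as either interval may be the upper left one.\<close>
    have touching: "antidiagonal_pair P {a, e} \<and> antidiagonal_pair P {e, a} \<or>
      antidiagonal_pair P {b, f} \<and> antidiagonal_pair P {f, b}"
      if "inner_interval P a b" "inner_interval P e f" "lower_right a b = upper_left e f" for a b e f
    proof -
      obtain a1 a2 b1 b2 e1 e2 f1 f2 where [simp]: "a = (a1, a2)" "b = (b1, b2)" "e = (e1, e2)" "f = (f1, f2)"
        by (metis surj_pair)
      have "e1 = b1" "f2 = a2" using that by (simp_all add: lower_right_def upper_left_def)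
      then have "inner_interval P (a1, e2) (b1, a2) \<or> inner_interval P (b1, a2) (f1, b2)"
        using C that unfolding completes_corners_def by simp
      then show ?thesis using \<open>e1 = b1\<close> \<open>f2 = a2\<close>
        by (auto simp: antidiagonal_pair_iff)
    qed
    show ?rhs
    proof (intro allI impI)
      fix a b e f d
      assume "inner_interval P a b" "inner_interval P e f"
        "d = lower_right a b \<and> d = upper_left e f \<or> d = lower_right e f \<and> d = upper_left a b"
      then show "antidiagonal_pair P {a, e} \<or> antidiagonal_pair P {b, f}"
        using touching[of a b e f] touching[of e f a b] by auto
    qed
  next
    assume R: ?rhs
    show completes_corners
      unfolding completes_corners_def
    proof (intro allI impI)
      fix i k m j l n
      assume H: "inner_interval P (i, l) (k, j)" "inner_interval P (k, n) (m, l)"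
      then have "antidiagonal_pair P {(i, l), (k, n)} \<or> antidiagonal_pair P {(k, j), (m, l)}"
        using R by (auto simp: lower_right_def upper_left_def)
      moreover have "i < k" "k < m" using H by (simp_all add: inner_interval_iff)
      ultimately show "inner_interval P (i, n) (k, l) \<or> inner_interval P (k, l) (m, j)"
        by (auto simp: antidiagonal_pair_iff inner_interval_iff)
    qed
  qed
  finally show ?thesis .
qed

theorem proposition2p1:
  fixes P :: "(nat \<times> nat) set set"
  assumes "polyomino P"
  shows
    "(\<forall>i\<in>{1, 3, 5, 7}.
        minors_form_reduced_gb TYPE('k::field) (grevlex (vertex_less i)) P \<longleftrightarrow>
        (\<forall>a b e. inner_interval P a b \<longrightarrow> inner_interval P b e \<longrightarrow>
           inner_interval P a (upper_left b e) \<or> inner_interval P a (lower_right b e)))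
     \<and>
     (\<forall>i\<in>{2, 4, 6, 8}.
        minors_form_reduced_gb TYPE('k::field) (grevlex (vertex_less i)) P \<longleftrightarrow>
        (\<forall>a b e f d. inner_interval P a b \<longrightarrow> inner_interval P e f \<longrightarrow>
           (d = lower_right a b \<and> d = upper_left e f \<or>
            d = lower_right e f \<and> d = upper_left a b) \<longrightarrow>
           antidiagonal_pair P {a, e} \<or> antidiagonal_pair P {b, f}))"
proof (intro conjI ballI)
  fix i :: nat assume "i \<in> {1, 3, 5, 7}"
  with assms show "minors_form_reduced_gb TYPE('k) (grevlex (vertex_less i)) P \<longleftrightarrow>
        (\<forall>a b e. inner_interval P a b \<longrightarrow> inner_interval P b e \<longrightarrow>
           inner_interval P a (upper_left b e) \<or> inner_interval P a (lower_right b e))"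
    by (rule minors_form_reduced_gb_iff_odd)
next
  fix i :: nat assume "i \<in> {2, 4, 6, 8}"
  with assms show "minors_form_reduced_gb TYPE('k) (grevlex (vertex_less i)) P \<longleftrightarrow>
        (\<forall>a b e f d. inner_interval P a b \<longrightarrow> inner_interval P e f \<longrightarrow>
           (d = lower_right a b \<and> d = upper_left e f \<or>
            d = lower_right e f \<and> d = upper_left a b) \<longrightarrow>
           antidiagonal_pair P {a, e} \<or> antidiagonal_pair P {b, f})"
    by (rule minors_form_reduced_gb_iff_even)
qed

end
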